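(* Define $f:[0,1]\to\mathbb{R}$ by $$f(x)=\begin{cases} c\ln l-\tfrac13(c\ln c-c)+\tfrac16\big((2x-1)^3-(2l-1)^3\big), & 0\le x\le l,\\[2pt] c\ln x-\tfrac13(c\ln c-c), & l\le x\le r,\\[2pt] c\ln r-\tfrac13(c\ln c-c)+\tfrac14(x^2-r^2)-\tfrac16(x^3-r^3), & r\le x\le 1,\end{cases}$$ and let $g=h=f$. Then the triple $(f,g,h)$ is a dual solution for the cost function $c(x,y,z)=xyz$ on $[0,1]^3$.
   Context: Constants: $l\approx 0.0945$ is the unique root in $(0,1/4)$ of the equation $9t+\ln(1-2t)-\ln t-3=0$, $r=1-2l$, and (as a number) $c=lr^2$. A dual solution for the cost $xyz$ is a triple of Lebesgue integrable functions $f,g,h:[0,1]\to\mathbb{R}$ with $f(x)+g(y)+h(z)\le xyz$ for all $x,y,z\in[0,1]$ that maximizes $\int_0^1 f+\int_0^1 g+\int_0^1 h$ (with respect to Lebesgue measure) among all such triples. *)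

theory Defs
  imports "HOL-Analysis.Analysis"
begin

definition cl :: real where
  "cl = (THE t. 0 < t \<and> t < 1/4 \<and> 9 * t + ln (1 - 2 * t) - ln t - 3 = 0)"

definition cr :: real where
  "cr = 1 - 2 * cl"

definition cc :: real where
  "cc = cl * cr\<^sup>2"

text \<open>The description operator in the definition of \<open>cl\<close> denotes a genuine root.\<close>

lemma cl_ex1:
  "\<exists>!t::real. 0 < t \<and> t < 1/4 \<and> 9 * t + ln (1 - 2 * t) - ln t - 3 = 0"
proof -
  define F where "F = (\<lambda>t::real. 9 * t + ln (1 - 2 * t) - ln t - 3)"
  have der: "(F has_real_derivative (9 - 2 / (1 - 2 * t) - 1 / t)) (at t)"
    if "0 < t" "t < 1/2" for t
    unfolding F_def using that by (auto intro!: derivative_eq_intros simp: divide_simps)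
  have der_eq: "9 - 2 / (1 - 2 * t) - 1 / t = - ((6 * t - 1) * (3 * t - 1)) / (t * (1 - 2 * t))"
    if "0 < t" "t < 1/2" for t :: real
    using that by (simp add: divide_simps) (simp add: algebra_simps)
  have dec: "F b < F a" if "0 < a" "a < b" "b \<le> 1/6" for a b
  proof (rule DERIV_neg_imp_decreasing_open[OF \<open>a < b\<close>])
    fix x assume x: "a < x" "x < b"
    have "(6 * x - 1) * (3 * x - 1) > 0"
      using x that by (intro mult_neg_neg) auto
    then have "9 - 2 / (1 - 2 * x) - 1 / x < 0"
      using x that by (subst der_eq) (auto simp: divide_less_0_iff zero_less_mult_iff)
    then show "\<exists>y. (F has_real_derivative y) (at x) \<and> y < 0"
      using der[of x] x that by auto
  next
    show "continuous_on {a..b} F"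
      using that by (intro continuous_at_imp_continuous_on ballI DERIV_isCont[OF der]) auto
  qed
  have inc: "F a \<le> F b" if "1/6 \<le> a" "a \<le> b" "b \<le> 1/4" for a b
  proof (rule DERIV_nonneg_imp_nondecreasing[OF \<open>a \<le> b\<close>])
    fix x assume x: "a \<le> x" "x \<le> b"
    have "(6 * x - 1) * (3 * x - 1) \<le> 0"
      using x that by (intro mult_nonneg_nonpos) auto
    then have "9 - 2 / (1 - 2 * x) - 1 / x \<ge> 0"
      using x that by (subst der_eq) (auto intro!: divide_nonpos_pos)
    then show "\<exists>y. (F has_real_derivative y) (at x) \<and> 0 \<le> y"
      using der[of x] x that by auto
  qed
  have "ln (1/4::real) = - 2 * ln 2"
    using ln_realpow[of "2::real" 2] by (simp add: ln_div)
  then have F4: "F (1/4) < 0"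
    using ln2_le_25_over_36 by (simp add: F_def ln_div)
  have neg: "F t < 0" if "1/6 \<le> t" "t \<le> 1/4" for t
    using inc[of t "1/4"] that F4 by auto
  define a where "a = exp (- 4 :: real)"
  have e: "exp (4::real) \<ge> 5" using exp_ge_add_one_self[of 4] by simp
  then have a: "0 < a" "a \<le> 1/5"
    by (auto simp: a_def exp_minus field_simps)
  have "ln (1 - 2 * a) \<ge> 1 - 1 / (1 - 2 * a)"
    using ln_le_minus_one[of "1 / (1 - 2 * a)"] a by (simp add: ln_div)
  moreover have "1 / (1 - 2 * a) \<le> 5/3"
    using a by (simp add: field_simps)
  moreover have "ln a = - 4"
    by (simp add: a_def)
  ultimately have Fa: "F a > 0"
    using a unfolding F_def by linarith
  have "continuous_on {a..1/4} F"
    using a by (intro continuous_at_imp_continuous_on ballI DERIV_isCont[OF der]) auto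
  then have "\<exists>t\<ge>a. t \<le> 1/4 \<and> F t = 0"
    using a F4 Fa by (intro IVT2') auto
  then obtain t where t: "a \<le> t" "t \<le> 1/4" "F t = 0" by blast
  have t4: "t < 1/4"
    using t F4 by (cases "t = 1/4") auto
  have small: "s < 1/6" if "s < 1/4" "F s = 0" for s
    using neg[of s] that by (cases "1/6 \<le> s") auto
  have "\<exists>!t. 0 < t \<and> t < 1/4 \<and> F t = 0"
  proof (rule ex1I[of _ t])
    show "0 < t \<and> t < 1/4 \<and> F t = 0"
      using a t t4 by auto
  next
    fix s assume s: "0 < s \<and> s < 1/4 \<and> F s = 0"
    have "s < 1/6" "t < 1/6" "0 < t"
      using small[of s] small[of t] s t t4 a by auto
    then show "s = t"
      using dec[of s t] dec[of t s] s t by (cases s t rule: linorder_cases) auto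
  qed
  then show ?thesis by (simp add: F_def)
qed

text \<open>Functions on \<open>[0,1]\<close> are represented by total functions \<open>real \<Rightarrow> real\<close>; only the values
  on \<open>{0..1}\<close> are constrained or used.\<close>

definition dual_admissible ::
  "(real \<Rightarrow> real \<Rightarrow> real \<Rightarrow> real) \<Rightarrow> (real \<Rightarrow> real) \<Rightarrow> (real \<Rightarrow> real) \<Rightarrow> (real \<Rightarrow> real) \<Rightarrow> bool" where
  "dual_admissible C f g h \<longleftrightarrow>
     set_integrable lebesgue {0..1} f \<and>
     set_integrable lebesgue {0..1} g \<and>
     set_integrable lebesgue {0..1} h \<and>
     (\<forall>x\<in>{0..1}. \<forall>y\<in>{0..1}. \<forall>z\<in>{0..1}. f x + g y + h z \<le> C x y z)"

definition dual_value :: "(real \<Rightarrow> real) \<Rightarrow> (real \<Rightarrow> real) \<Rightarrow> (real \<Rightarrow> real) \<Rightarrow> real" where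
  "dual_value f g h =
     (LINT x:{0..1}|lebesgue. f x) + (LINT y:{0..1}|lebesgue. g y) + (LINT z:{0..1}|lebesgue. h z)"

definition dual_solution ::
  "(real \<Rightarrow> real \<Rightarrow> real \<Rightarrow> real) \<Rightarrow> (real \<Rightarrow> real) \<Rightarrow> (real \<Rightarrow> real) \<Rightarrow> (real \<Rightarrow> real) \<Rightarrow> bool" where
  "dual_solution C f g h \<longleftrightarrow>
     dual_admissible C f g h \<and>
     (\<forall>f' g' h'. dual_admissible C f' g' h' \<longrightarrow> dual_value f' g' h' \<le> dual_value f g h)"

text \<open>Adjacent branches agree at the breakpoints \<open>cl\<close> and \<open>cr\<close>, so assigning each breakpoint
  to the left branch is immaterial.\<close>

definition dual_f :: "real \<Rightarrow> real" where
  "dual_f x =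
    (if x \<le> cl then
       cc * ln cl - (1/3) * (cc * ln cc - cc) + (1/6) * ((2 * x - 1) ^ 3 - (2 * cl - 1) ^ 3)
     else if x \<le> cr then
       cc * ln x - (1/3) * (cc * ln cc - cc)
     else
       cc * ln cr - (1/3) * (cc * ln cc - cc) + (1/4) * (x\<^sup>2 - cr\<^sup>2) - (1/6) * (x ^ 3 - cr ^ 3))"

end

theory Submission
  imports Defs
begin

text \<open>
  Write \<open>l, r, c\<close> for \<open>cl, cr, cc\<close> and \<open>f\<close> for \<open>dual_f\<close>.

  Feasibility: \<open>f\<close> is \<open>C\<^sup>1\<close>, and \<open>x * f' x\<close> increases on \<open>[0,l]\<close>, is constant on \<open>[l,r]\<close> and decreases
  on \<open>[r,1]\<close>. At an interior minimum of \<open>x y z - f x - f y - f z\<close> on the cube one has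
  \<open>x f' x = y f' y = z f' z = x y z\<close>, which forces \<open>(x,y,z)\<close> to lie on the contact set consisting of the
  permutations of \<open>(t, 1 - 2t, 1 - 2t)\<close> with \<open>t \<le> l\<close> and of the surface \<open>x y z = c\<close> in \<open>[l,r]\<^sup>3\<close>; there
  the minimum is zero.

  Optimality: for a competitor, let \<open>\<phi>\<close> be the sum of its three functions minus \<open>3 f\<close>. Then
  \<open>\<phi> x + \<phi> y + \<phi> z \<le> 0\<close> on the contact set, and \<open>\<integral> \<phi> \<le> 0\<close> is needed. The curve
  \<open>(t, 1 - 2t, 1 - 2t)\<close> handles \<open>[0,l] \<union> [r,1]\<close>. On \<open>[l,r]\<close> substitute \<open>x = r exp (- L v)\<close> with
  \<open>L = 3 - 9 l = ln (r / l)\<close>; the surface becomes \<open>u + v + w = 1\<close> in \<open>[0,1]\<^sup>3\<close>. Integrating along segments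
  in this triangle gives linear inequalities for the primitive \<open>F\<close> of \<open>\<phi>\<close>. Integration by parts
  reduces the claim to \<open>\<integral> F s exp (- L s) \<le> 0\<close> when \<open>F 1 = 0\<close>, and finitely many segment inequalities
  show that already the sum of the integrand over the six points
  \<open>s, 1/3 - s, 1/3 + s, 2/3 - s, 2/3 + s, 1 - s\<close> is nonpositive for every \<open>s\<close> in \<open>(0, 1/6)\<close>.
\<close>

subsection \<open>Integrating along segments of the triangle\<close>

text \<open>Affine substitution. The quotient does not change when \<open>u\<close> and
  \<open>v\<close> are exchanged, so a coordinate that decreases along a segment is covered as
  well.\<close>

lemma has_integral_segment:
  fixes f :: "real \<Rightarrow> real"
  assumes f: "f integrable_on {0..1}" and uv: "u \<in> {0..1}" "v \<in> {0..1}" "u \<noteq> v"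
  shows "((\<lambda>x. f (u + (v - u) * x)) has_integral (integral {0..v} f - integral {0..u} f) / (v - u)) {0..1}"
proof -
  define a where "a = min u v"
  define b where "b = max u v"
  have ab: "0 \<le> a" "a < b" "b \<le> 1" using uv by (auto simp: a_def b_def)
  have fb: "f integrable_on {0..b}" using f ab by (auto intro: integrable_subinterval_real)
  have fab: "f integrable_on {a..b}" using f ab by (auto intro: integrable_subinterval_real)
  have "integral {a..b} f = integral {0..b} f - integral {0..a} f"
    using Henstock_Kurzweil_Integration.integral_combine[of 0 a b f] ab fb by simp
  then have "(f has_integral (integral {0..b} f - integral {0..a} f)) (cbox a b)"
    using fab by (simp add: has_integral_iff)
  from has_integral_affinity[OF this, of "v - u" u] uv
  have "((\<lambda>x. f (u + (v - u) * x)) has_integral (integral {0..b} f - integral {0..a} f) / \<bar>v - u\<bar>)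
      ((\<lambda>x. (1 / (v - u)) * x + - ((1 / (v - u)) * u)) ` {a..b})"
    by (simp add: add.commute)
  moreover have "(\<lambda>x. (1 / (v - u)) * x + - ((1 / (v - u)) * u)) ` {a..b} = {0..1}"
  proof (cases "u < v")
    case True
    then show ?thesis
      by (subst image_affinity_atLeastAtMost) (auto simp: a_def b_def simp flip: diff_divide_distrib)
  next
    case False
    then have "(v - u) / (v - u) = 1" "v < u" using uv by auto
    then show ?thesis
      by (subst image_affinity_atLeastAtMost) (auto simp: a_def b_def simp flip: diff_divide_distrib)
  qed
  moreover have "(integral {0..b} f - integral {0..a} f) / \<bar>v - u\<bar> = (integral {0..v} f - integral {0..u} f) / (v - u)"
    using uv by (auto simp: a_def b_def min_def max_def field_simps)
  ultimately show ?thesis by simp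
qed

text \<open>The inequality \<open>tri\<close> is averaged along the segment from \<open>u\<close> to
  \<open>v\<close>; each coordinate contributes the mean of \<open>f\<close> between its end values.
  A coordinate at rest would contribute a value of \<open>f\<close> instead of its primitive, hence
  the three conditions in \<open>ne\<close>.\<close>

lemma triple_segment_le_0:
  fixes f :: "real \<Rightarrow> real"
  assumes f: "f integrable_on {0..1}"
    and tri: "\<And>a b c. a \<in> {0..1} \<Longrightarrow> b \<in> {0..1} \<Longrightarrow> c \<in> {0..1} \<Longrightarrow> a + b + c = 1 \<Longrightarrow> f a + f b + f c \<le> 0"
    and u: "u1 \<in> {0..1}" "u2 \<in> {0..1}" "u3 \<in> {0..1}" "u1 + u2 + u3 = 1"
    and v: "v1 \<in> {0..1}" "v2 \<in> {0..1}" "v3 \<in> {0..1}" "v1 + v2 + v3 = 1"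
    and ne: "u1 \<noteq> v1" "u2 \<noteq> v2" "u3 \<noteq> v3"
  defines "F \<equiv> \<lambda>x. integral {0..x} f"
  shows "(F v1 - F u1) / (v1 - u1) + (F v2 - F u2) / (v2 - u2) + (F v3 - F u3) / (v3 - u3) \<le> 0"
proof (rule has_integral_le)
  show "((\<lambda>x. f (u1 + (v1 - u1) * x) + f (u2 + (v2 - u2) * x) + f (u3 + (v3 - u3) * x)) has_integral
     (F v1 - F u1) / (v1 - u1) + (F v2 - F u2) / (v2 - u2) + (F v3 - F u3) / (v3 - u3)) {0..1}"
    unfolding F_def using u v ne by (intro has_integral_add has_integral_segment f) auto
  show "((\<lambda>x. 0) has_integral (0::real)) {0..1::real}" by simp
  fix x :: real assume x: "x \<in> {0..1}"
  have in01: "p + (q - p) * x \<in> {0..1}" if "p \<in> {0..1}" "q \<in> {0..1}" for p q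
  proof -
    have "p + (q - p) * x = (1 - x) * p + x * q" by (simp add: algebra_simps)
    moreover have "(1 - x) * p + x * q \<le> (1 - x) * 1 + x * 1"
      using that x by (intro add_mono mult_left_mono) auto
    ultimately show ?thesis using that x by auto
  qed
  show "f (u1 + (v1 - u1) * x) + f (u2 + (v2 - u2) * x) + f (u3 + (v3 - u3) * x) \<le> 0"
  proof (rule tri)
    have "u1 + (v1 - u1) * x + (u2 + (v2 - u2) * x) + (u3 + (v3 - u3) * x)
      = (1 - x) * (u1 + u2 + u3) + x * (v1 + v2 + v3)" by (simp add: algebra_simps)
    then show "u1 + (v1 - u1) * x + (u2 + (v2 - u2) * x) + (u3 + (v3 - u3) * x) = 1" using u v by simp
  qed (use in01 u v in auto)
qed

text \<open>The six maps carry (0, 1/6) onto the six open sixths of the unit interval, so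
  integrating the orbit sum over (0, 1/6) recovers the integral of \<open>g\<close>.\<close>

lemma integral_orbits_le_0:
  fixes g :: "real \<Rightarrow> real"
  assumes g: "g integrable_on {0..1}"
    and orb: "\<And>s. 0 < s \<Longrightarrow> s < 1/6 \<Longrightarrow> g s + g (1/3 - s) + g (1/3 + s) + g (2/3 - s) + g (2/3 + s) + g (1 - s) \<le> 0"
  shows "integral {0..1} g \<le> 0"
proof -
  define F where "F = (\<lambda>x. integral {0..x} g)"
  define h where "h = (\<lambda>x::real. g (0 + (1/6 - 0) * x) + g (1/3 + (1/6 - 1/3) * x) + g (1/3 + (1/2 - 1/3) * x)
     + g (2/3 + (1/2 - 2/3) * x) + g (2/3 + (5/6 - 2/3) * x) + g (1 + (5/6 - 1) * x))"
  have "(h has_integral (F (1/6) - F 0) / (1/6 - 0) + (F (1/6) - F (1/3)) / (1/6 - 1/3)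
     + (F (1/2) - F (1/3)) / (1/2 - 1/3) + (F (1/2) - F (2/3)) / (1/2 - 2/3)
     + (F (5/6) - F (2/3)) / (5/6 - 2/3) + (F (5/6) - F 1) / (5/6 - 1)) {0..1}"
    unfolding h_def F_def by (intro has_integral_add has_integral_segment g) auto
  \<comment> \<open>All denominators are 1/6 up to sign, so the six quotients telescope.\<close>
  then have h: "(h has_integral 6 * F 1) {0..1}"
    by (rule has_integral_eq_rhs) (simp add: F_def)
  have "6 * F 1 \<le> 0"
  proof (rule has_integral_le)
    show "(h has_integral 6 * F 1) ({0<..<1})"
      using h has_integral_open_interval[of h "6 * F 1" 0 "1::real"] by simp
    show "((\<lambda>x. 0) has_integral (0::real)) {0<..<1::real}" by simp
    fix x :: real assume "x \<in> {0<..<1}"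
    then show "h x \<le> 0" using orb[of "x / 6"] by (simp add: h_def)
  qed
  then show ?thesis by (simp add: F_def)
qed

text \<open>
  Since \<open>F\<close> need not be differentiable everywhere, the defect \<open>D\<close> of the formula on \<open>{a..x}\<close> is shown
  to have derivative zero: its increments are bounded by \<open>2 * M * (y - x)\<close> times the increments of
  the continuous primitive \<open>N\<close> of \<open>\<bar>f\<bar>\<close>.
\<close>

lemma integral_mult_by_parts:
  fixes f g g' :: "real \<Rightarrow> real"
  assumes f: "f absolutely_integrable_on {a..b}" and ab: "a \<le> b"
    and g: "\<And>x. x \<in> {a..b} \<Longrightarrow> (g has_real_derivative g' x) (at x within {a..b})"
    and g': "continuous_on {a..b} g'"
  defines "F \<equiv> \<lambda>x. integral {a..x} f"
  shows "integral {a..b} (\<lambda>x. f x * g x) = F b * g b - integral {a..b} (\<lambda>x. F x * g' x)"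
proof -
  obtain M where M: "\<And>x. x \<in> {a..b} \<Longrightarrow> \<bar>g' x\<bar> \<le> M"
    using compact_imp_bounded[OF compact_continuous_image[OF g' compact_Icc]]
    unfolding bounded_iff by (metis imageI real_norm_def)
  then have "\<bar>g' a\<bar> \<le> M" using ab by simp
  then have M0: "M \<ge> 0" using abs_ge_zero order_trans by blast
  have cg: "continuous_on {a..b} g" using g DERIV_continuous_on by blast
  have fi: "f integrable_on {a..b}" and afi: "(\<lambda>x. \<bar>f x\<bar>) integrable_on {a..b}"
    using f by (auto simp: absolutely_integrable_on_def)
  have cF: "continuous_on {a..b} F" unfolding F_def by (rule indefinite_integral_continuous_1[OF fi])
  have fg: "(\<lambda>x. f x * h x) absolutely_integrable_on {a..b}" if "continuous_on {a..b} h" for h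
  proof -
    have "(\<lambda>x. h x * f x) absolutely_integrable_on {a..b}"
      using that f by (intro absolutely_integrable_bounded_measurable_product_real)
        (auto intro: continuous_imp_measurable_on_sets_lebesgue compact_imp_bounded compact_continuous_image)
    then show ?thesis by (simp add: mult.commute)
  qed
  define N where "N = (\<lambda>x. integral {a..x} (\<lambda>x. \<bar>f x\<bar>))"
  have cN: "continuous_on {a..b} N" unfolding N_def by (rule indefinite_integral_continuous_1[OF afi])
  define D where "D = (\<lambda>z. integral {a..z} (\<lambda>x. f x * g x) - F z * g z + integral {a..z} (\<lambda>x. F x * g' x))"
  have inc: "integral {a..y} h - integral {a..x} h = integral {x..y} h"
    if "h integrable_on {a..b}" "a \<le> x" "x \<le> y" "y \<le> b" for h :: "real \<Rightarrow> real" and x y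
    using Henstock_Kurzweil_Integration.integral_combine[of a x y h] that integrable_subinterval_real[of h a b a y] by auto
  have sub: "h integrable_on {x..y}" if "h integrable_on {a..b}" "a \<le> x" "y \<le> b" for h :: "real \<Rightarrow> real" and x y
    using that by (auto intro: integrable_subinterval_real)
  have bound: "\<bar>D y - D x\<bar> \<le> 2 * M * (y - x) * (N y - N x)" if xy: "a \<le> x" "x \<le> y" "y \<le> b" for x y
  proof -
    note sub' = sub[OF _ xy(1,3)]
    have int1: "(\<lambda>v. f v * g v) integrable_on {x..y}" 
      using fg[OF cg] by (intro sub') (auto simp: absolutely_integrable_on_def)
    have int2: "f integrable_on {x..y}" "(\<lambda>v. \<bar>f v\<bar>) integrable_on {x..y}" using fi afi sub' by auto
    have int3: "(\<lambda>v. F v * g' v) integrable_on {x..y}"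
      by (intro sub' integrable_continuous_real continuous_intros cF g')
    have int4: "g' integrable_on {x..y}" by (intro sub' integrable_continuous_real g')
    have gyx: "integral {x..y} g' = g y - g x"
    proof (rule integral_unique, rule fundamental_theorem_of_calculus[OF xy(2)])
      fix v assume "v \<in> {x..y}"
      then show "(g has_vector_derivative g' v) (at v within {x..y})"
        using g[of v] xy DERIV_subset[of g "g' v" v "{a..b}" "{x..y}"]
        by (auto simp: has_real_derivative_iff_has_vector_derivative)
    qed
    have Nyx: "N y - N x = integral {x..y} (\<lambda>v. \<bar>f v\<bar>)" unfolding N_def using inc[OF afi xy] .
    have Fyx: "F y - F x = integral {x..y} f" unfolding F_def using inc[OF fi xy] .
    have gl: "\<bar>g v - g y\<bar> \<le> M * (y - x)" if "v \<in> {x..y}" for v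
    proof -
      have "\<bar>g y - g v\<bar> \<le> M * \<bar>y - v\<bar>"
        using field_differentiable_bound[of "{a..b}" g g' M y v] g M that xy by auto
      also have "\<dots> \<le> M * (y - x)" using that M0 by (intro mult_left_mono) auto
      finally show ?thesis by (simp add: abs_minus_commute)
    qed
    have Fl: "\<bar>F v - F x\<bar> \<le> N y - N x" if "v \<in> {x..y}" for v
    proof -
      have "F v - F x = integral {x..v} f" unfolding F_def using inc[OF fi, of x v] xy that by auto
      then have "\<bar>F v - F x\<bar> \<le> integral {x..v} (\<lambda>v. \<bar>f v\<bar>)"
        using Henstock_Kurzweil_Integration.integral_norm_bound_integral[of f "{x..v}" "\<lambda>v. \<bar>f v\<bar>"] sub[OF fi] sub[OF afi] xy that by auto
      also have "\<dots> \<le> integral {x..y} (\<lambda>v. \<bar>f v\<bar>)"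
        using that sub[OF afi] xy by (intro integral_subset_le) auto
      finally show ?thesis using Nyx by simp
    qed
    have i1: "(\<lambda>v. f v * (g v - g y)) integrable_on {x..y}"
      using integrable_diff[OF int1 integrable_on_mult_left[OF int2(1), of "g y"]] by (simp add: right_diff_distrib)
    have i2: "(\<lambda>v. (F v - F x) * g' v) integrable_on {x..y}"
      using integrable_diff[OF int3 integrable_on_mult_right[OF int4, of "F x"]] by (simp add: left_diff_distrib)
    \<comment> \<open>Recentring \<open>g\<close> at \<open>y\<close> and \<open>F\<close> at
      \<open>x\<close> absorbs the boundary terms exactly; each integral then carries one factor of
      size \<open>M * (y - x)\<close> or \<open>N y - N x\<close>.\<close>
    have "D y - D x = integral {x..y} (\<lambda>v. f v * (g v - g y)) + integral {x..y} (\<lambda>v. (F v - F x) * g' v)"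
    proof -
      have "integral {x..y} (\<lambda>v. f v * (g v - g y)) = integral {x..y} (\<lambda>v. f v * g v) - (F y - F x) * g y"
        unfolding Fyx right_diff_distrib using int1 int2 by (subst integral_diff) (auto simp: integrable_on_mult_left)
      moreover have "integral {x..y} (\<lambda>v. (F v - F x) * g' v) = integral {x..y} (\<lambda>v. F v * g' v) - F x * (g y - g x)"
        unfolding gyx[symmetric] left_diff_distrib using int3 int4 by (subst integral_diff) (auto simp: integrable_on_mult_right)
      moreover have "D y - D x = integral {x..y} (\<lambda>v. f v * g v) - (F y * g y - F x * g x) + integral {x..y} (\<lambda>v. F v * g' v)"
      proof -
        have "(\<lambda>v. f v * g v) integrable_on {a..b}" using fg[OF cg] by (auto simp: absolutely_integrable_on_def)
        moreover have "(\<lambda>v. F v * g' v) integrable_on {a..b}" by (intro integrable_continuous_real continuous_intros cF g')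
        ultimately show ?thesis using inc[OF _ xy, of "\<lambda>v. f v * g v"] inc[OF _ xy, of "\<lambda>v. F v * g' v"] by (simp add: D_def)
      qed
      ultimately show ?thesis by (simp add: algebra_simps)
    qed
    moreover have "\<bar>integral {x..y} (\<lambda>v. f v * (g v - g y))\<bar> \<le> M * (y - x) * (N y - N x)"
    proof -
      have "\<bar>integral {x..y} (\<lambda>v. f v * (g v - g y))\<bar> \<le> integral {x..y} (\<lambda>v. M * (y - x) * \<bar>f v\<bar>)"
        using gl int2(2) i1
        by (intro Henstock_Kurzweil_Integration.integral_norm_bound_integral[where 'a=real, unfolded real_norm_def])
           (auto simp: abs_mult mult.commute[of _ "\<bar>f _\<bar>"] intro!: mult_left_mono integrable_on_mult_left integrable_on_mult_right)
      then show ?thesis using Nyx by simp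
    qed
    moreover have "\<bar>integral {x..y} (\<lambda>v. (F v - F x) * g' v)\<bar> \<le> M * (y - x) * (N y - N x)"
    proof -
      have "\<bar>integral {x..y} (\<lambda>v. (F v - F x) * g' v)\<bar> \<le> integral {x..y} (\<lambda>v. (N y - N x) * M)"
        using Fl M M0 xy i2
        by (intro Henstock_Kurzweil_Integration.integral_norm_bound_integral[where 'a=real, unfolded real_norm_def])
           (auto simp: abs_mult intro!: mult_mono intro: order_trans[OF abs_ge_zero])
      then show ?thesis using xy by (simp add: ac_simps)
    qed
    ultimately show ?thesis by linarith
  qed
  have "(D has_field_derivative 0) (at x within {a..b})" if x: "x \<in> {a..b}" for x
  proof -
    have "((\<lambda>y. (D y - D x) / (y - x)) \<longlongrightarrow> 0) (at x within {a..b})"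
    proof (rule Lim_null_comparison)
      show "\<forall>\<^sub>F y in at x within {a..b}. norm ((D y - D x) / (y - x)) \<le> 2 * M * \<bar>N y - N x\<bar>"
      proof (rule eventually_at_topological[THEN iffD2], intro exI[of _ UNIV] conjI ballI impI)
        fix y assume y: "y \<noteq> x" "y \<in> {a..b}"
        have "\<bar>D y - D x\<bar> \<le> 2 * M * \<bar>y - x\<bar> * \<bar>N y - N x\<bar>"
        proof (cases "x \<le> y")
          case True
          have "2 * M * (y - x) * (N y - N x) \<le> 2 * M * \<bar>y - x\<bar> * \<bar>N y - N x\<bar>"
            using M0 True by (auto intro!: mult_left_mono)
          then show ?thesis using bound[of x y] True x y by auto
        next
          case False
          have "2 * M * (x - y) * (N x - N y) \<le> 2 * M * \<bar>y - x\<bar> * \<bar>N y - N x\<bar>"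
            using M0 False by (auto intro!: mult_left_mono)
          then show ?thesis using bound[of y x] False x y by (auto simp: abs_minus_commute)
        qed
        then show "norm ((D y - D x) / (y - x)) \<le> 2 * M * \<bar>N y - N x\<bar>"
          using y by (simp add: field_simps)
      qed auto
      have "(N \<longlongrightarrow> N x) (at x within {a..b})" using cN x by (auto simp: continuous_on_def)
      then have "((\<lambda>y. 2 * M * \<bar>N y - N x\<bar>) \<longlongrightarrow> 2 * M * \<bar>N x - N x\<bar>) (at x within {a..b})"
        by (intro tendsto_intros)
      then show "((\<lambda>y. 2 * M * \<bar>N y - N x\<bar>) \<longlongrightarrow> 0) (at x within {a..b})" by simp
    qed
    then show ?thesis by (simp add: has_field_derivative_iff)
  qed
  then have "\<exists>c. \<forall>x\<in>{a..b}. D x = c"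
    by (intro has_field_derivative_zero_constant) auto
  then have "D b = D a" using ab by force
  then show ?thesis by (simp add: D_def F_def)
qed

subsection \<open>The inequality on a single orbit\<close>

lemma low_pair_bound:
  fixes \<tau> E q x1 x2 t :: real
  assumes "0 < \<tau>" "\<tau> < 1/2" "t \<le> 0"
    and d: "\<tau> * q \<le> (3 - \<tau>) * E ^ 3" and q: "q \<ge> 0"
    and h1: "(3 - \<tau>) * x1 + \<tau> * x2 \<le> 0"
    and h4: "t + (t - x1) / (1 - \<tau>) + (x2 - t) / (2 - \<tau>) \<le> 0"
  shows "q * x1 + E ^ 3 * x2 \<le> (2 - \<tau> + 1 / (1 - \<tau>)) * (E ^ 3 - \<tau> / (3 - \<tau>) * q) * (- t)"
proof -
  define K where "K = 2 - \<tau> + 1 / (1 - \<tau>)"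
  define d where "d = E ^ 3 - \<tau> / (3 - \<tau>) * q"
  have d0: "d \<ge> 0" using assms by (simp add: d_def field_simps)
  have K0: "K \<ge> 0" using assms by (simp add: K_def)
  have x1: "x1 \<le> - (\<tau> / (3 - \<tau>)) * x2"
    using h1 assms by (simp add: field_simps)
  have "q * x1 + E ^ 3 * x2 \<le> d * x2"
    using mult_left_mono[OF x1 q] by (simp add: d_def algebra_simps)
  also have "d * x2 \<le> K * d * (- t)"
  proof (cases "x2 \<le> 0")
    case True
    then have "d * x2 \<le> 0" using d0 by (simp add: mult_nonneg_nonpos)
    also have "0 \<le> K * d * (- t)" using d0 K0 assms(3) by (simp add: mult_nonneg_nonpos)
    finally show ?thesis .
  next
    case False
    then have "(\<tau> / (3 - \<tau>)) * x2 \<ge> 0" using assms by simp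
    then have "x1 \<le> 0" using x1 by simp
    then have "(- x1) / (1 - \<tau>) \<ge> 0" using assms by (intro divide_nonneg_pos) auto
    then have "t + t / (1 - \<tau>) + x2 / (2 - \<tau>) - t / (2 - \<tau>) \<le> 0"
      using h4 by (simp add: diff_divide_distrib)
    then have "(t + t / (1 - \<tau>) + x2 / (2 - \<tau>) - t / (2 - \<tau>)) * (2 - \<tau>) \<le> 0"
      using assms by (simp add: mult_nonpos_nonneg)
    moreover have "(t + t / (1 - \<tau>) + x2 / (2 - \<tau>) - t / (2 - \<tau>)) * (2 - \<tau>) = x2 + K * t"
    proof -
      have 1: "x2 / (2 - \<tau>) * (2 - \<tau>) = x2" "t / (2 - \<tau>) * (2 - \<tau>) = t" using assms by auto
      have 2: "t / (1 - \<tau>) * (2 - \<tau>) = t + 1 / (1 - \<tau>) * t" using assms by (simp add: field_simps)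
      show ?thesis unfolding K_def distrib_right left_diff_distrib 1 2 by (simp add: algebra_simps)
    qed
    ultimately have "x2 \<le> K * (- t)" by simp
    from mult_left_mono[OF this d0] show ?thesis by (simp add: algebra_simps)
  qed
  finally show ?thesis by (simp add: K_def d_def)
qed

text \<open>A positive \<open>a'\<close> would make \<open>b'\<close> positive by \<open>h6\<close>
  and contradict \<open>h8\<close>. Hence \<open>a' \<le> 0\<close>, and \<open>h8\<close> scaled by
  \<open>r\<close> suffices, because the remaining coefficient of \<open>a'\<close> is
  nonnegative.\<close>

lemma high_pair_bound:
  fixes \<tau> E r a' b' t :: real
  assumes "0 < \<tau>" "\<tau> < 1/2" "t \<le> 0"
    and r: "0 \<le> r" "r * \<tau> \<le> E\<^sup>2 * (1 - \<tau>)"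
    and h6: "(1 - \<tau>) / (2 - \<tau>) * a' \<le> \<tau> / (1 + \<tau>) * b'"
    and h8: "(1 - \<tau>) * b' + \<tau> * a' \<le> t * (1 - \<tau> + \<tau>\<^sup>2)"
  shows "r * b' + E\<^sup>2 * a' \<le> r * t"
proof -
  have pos: "1 - \<tau> + \<tau>\<^sup>2 > 0" using assms(2) zero_le_power2[of \<tau>] by linarith
  have a': "a' \<le> 0"
  proof (rule ccontr)
    assume "\<not> a' \<le> 0"
    then have a: "a' > 0" by simp
    then have "(1 - \<tau>) / (2 - \<tau>) * a' > 0" using assms by simp
    then have "\<tau> / (1 + \<tau>) * b' > 0" using h6 by linarith
    moreover have "\<tau> / (1 + \<tau>) > 0" using assms by simp
    ultimately have "b' > 0" by (rule zero_less_mult_pos)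
    then have "(1 - \<tau>) * b' + \<tau> * a' > 0" using a assms by (simp add: add_pos_pos)
    moreover have "t * (1 - \<tau> + \<tau>\<^sup>2) \<le> 0" using pos assms by (simp add: mult_nonpos_nonneg)
    ultimately show False using h8 by linarith
  qed
  have "(1 - \<tau>) * (r * b' + E\<^sup>2 * a') = r * ((1 - \<tau>) * b' + \<tau> * a') + (E\<^sup>2 * (1 - \<tau>) - r * \<tau>) * a'"
    by (simp add: algebra_simps)
  also have "\<dots> \<le> r * (t * (1 - \<tau> + \<tau>\<^sup>2)) + 0"
    using mult_left_mono[OF h8 r(1)] r(2) a' by (intro add_mono) (auto simp: mult_nonneg_nonpos)
  also have "\<dots> \<le> (1 - \<tau>) * (r * t)"
    using mult_nonneg_nonpos[OF mult_nonneg_nonneg[OF r(1), of "\<tau>\<^sup>2"] assms(3)]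
    by (simp add: algebra_simps)
  finally show ?thesis using assms by simp
qed

text \<open>The bound is the value at \<tau> = 1/2, which is why the difference has the factor 1/2 -
  \<tau>.\<close>

lemma kappa_coeff_le:
  fixes \<tau> :: real assumes "0 < \<tau>" "\<tau> < 1/2"
  shows "2 - \<tau> + 1 / (1 - \<tau>) \<le> 7/2"
proof -
  have "7/2 - (2 - \<tau> + 1 / (1 - \<tau>)) = (1/2 - \<tau>) * (1 + \<tau>) / (1 - \<tau>)"
    using assms by (simp add: field_simps)
  also have "\<dots> \<ge> 0" using assms by simp
  finally show ?thesis by simp
qed

text \<open>The difference of the two sides is affine in \<open>q\<close>, so the end points q = 0
  (\<open>e0\<close>) and q = 1 (\<open>e1\<close>) suffice. It serves the orbit inequality when the
  parenthesis on the right is nonpositive.\<close>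

lemma margin_neg:
  fixes \<tau> E q :: real
  assumes \<tau>: "0 < \<tau>" "\<tau> < 1/2" and E: "0 \<le> E" "E \<le> 1/2" and q: "0 \<le> q" "q \<le> 1"
  shows "(2 - \<tau> + 1 / (1 - \<tau>)) * (E ^ 3 - \<tau> / (3 - \<tau>) * q) \<le> E * q + (E - E\<^sup>2 * q * ((2 + \<tau>) / (1 - \<tau>)))"
proof -
  define K where "K = 2 - \<tau> + 1 / (1 - \<tau>)"
  define a where "a = (2 + \<tau>) / (1 - \<tau>)"
  define b where "b = K * (\<tau> / (3 - \<tau>))"
  have K: "0 \<le> K" "K \<le> 7/2" using kappa_coeff_le[OF \<tau>] \<tau> by (auto simp: K_def)
  have a0: "a \<ge> 0" and b0: "b \<ge> 0" using \<tau> K by (auto simp: a_def b_def)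
  have E2: "E\<^sup>2 \<le> E / 2" using mult_left_mono[OF E(2,1)] by (simp add: power2_eq_square)
  have E2': "E\<^sup>2 \<le> 1/4" using E2 E by simp
  have E3: "E ^ 3 \<le> E / 4" using mult_left_mono[OF E2' E(1)] by (simp add: power2_eq_square power3_eq_cube)
  have e0: "K * E ^ 3 \<le> E"
  proof -
    have "K * E ^ 3 \<le> 7/2 * (E / 4)" using K E E3 by (intro mult_mono) auto
    also have "\<dots> \<le> E" using E by simp
    finally show ?thesis .
  qed
  \<comment> \<open>This is \<open>e1\<close> with \<open>E\<^sup>2\<close>, \<open>E ^ 3\<close>
    and \<open>b\<close> replaced by their bounds \<open>E / 2\<close>, \<open>E / 4\<close> and
    \<open>2 * E * b\<close>, divided by \<open>2 * E\<close>; only \<tau> is left.\<close>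
  have f: "0 \<le> 1 - a / 4 - K / 8 + b"
  proof -
    have p: "(1 - \<tau>) * (3 - \<tau>) > 0" using \<tau> by simp
    have c: "(1/2 - \<tau>) * (23/4 + 31/2 * \<tau> - 9 * \<tau>\<^sup>2) \<ge> 0"
    proof (intro mult_nonneg_nonneg)
      have "\<tau>\<^sup>2 \<le> 1/4" using power_mono[of \<tau> "1/2" 2] \<tau> by (simp add: power2_eq_square)
      then show "0 \<le> 23/4 + 31/2 * \<tau> - 9 * \<tau>\<^sup>2" using \<tau> by simp
    qed (use \<tau> in simp)
    have "(1 - a / 4 - K / 8 + b) * ((1 - \<tau>) * (3 - \<tau>)) = (1/2 - \<tau>) * (23/4 + 31/2 * \<tau> - 9 * \<tau>\<^sup>2) / 8 + 1/64"
      using \<tau> unfolding a_def b_def K_def by (simp add: divide_simps) (simp add: algebra_simps power2_eq_square power3_eq_cube)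
    then have "(1 - a / 4 - K / 8 + b) * ((1 - \<tau>) * (3 - \<tau>)) \<ge> 0" using c by simp
    then show ?thesis using p by (simp add: zero_le_mult_iff)
  qed
  have e1: "0 \<le> 2 * E - a * E\<^sup>2 + b - K * E ^ 3"
  proof -
    have "0 \<le> 2 * E * (1 - a / 4 - K / 8 + b)" using f E by simp
    also have "\<dots> = 2 * E - a * (E / 2) + 2 * E * b - K * (E / 4)" by (simp add: algebra_simps)
    also have "\<dots> \<le> 2 * E - a * E\<^sup>2 + b - K * E ^ 3"
      using mult_left_mono[OF E2 a0] mult_left_mono[OF E3 K(1)] mult_right_mono[of "2 * E" 1 b] b0 E by simp
    finally show ?thesis .
  qed
  have "0 \<le> (1 - q) * (E - K * E ^ 3) + q * (2 * E - a * E\<^sup>2 + b - K * E ^ 3)"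
    using e0 e1 q by simp
  then show ?thesis unfolding K_def[symmetric] a_def[symmetric]
    by (simp add: algebra_simps b_def)
qed

text \<open>Counterpart of \<open>margin_neg\<close> for a positive parenthesis. The difference of
  the two sides increases with \<open>q\<close>, so \<open>q\<close> may be lowered to
  \<open>w\<close>, the larger of its two lower bounds.\<close>

lemma margin_pos:
  fixes \<tau> E q :: real
  assumes \<tau>: "0 < \<tau>" "\<tau> < 1/2" and E: "2/5 \<le> E" "E \<le> 1/2" and q: "1 - 3/2 * \<tau> \<le> q" "E \<le> q"
  shows "(2 - \<tau> + 1 / (1 - \<tau>)) * (E ^ 3 - \<tau> / (3 - \<tau>) * q)
     \<le> E * q - (E - E\<^sup>2 * q * ((2 + \<tau>) / (1 - \<tau>))) * ((1 - \<tau>) / (1 + \<tau>))"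
proof -
  define K where "K = 2 - \<tau> + 1 / (1 - \<tau>)"
  define a where "a = (2 + \<tau>) / (1 + \<tau>)"
  define b where "b = K * (\<tau> / (3 - \<tau>))"
  define c where "c = (1 - \<tau>) / (1 + \<tau>)"
  have K: "0 \<le> K" "K \<le> 7/2" using kappa_coeff_le[OF \<tau>] \<tau> by (auto simp: K_def)
  have a0: "a \<ge> 0" and b0: "b \<ge> 0" using \<tau> K by (auto simp: a_def b_def)
  \<comment> \<open>The chord of the square over [2/5, 1/2].\<close>
  have E2: "E\<^sup>2 \<le> 9/10 * E - 1/5"
  proof -
    have "(1/2 - E) * (E - 2/5) = 9/10 * E - 1/5 - E\<^sup>2" by (simp add: field_simps power2_eq_square)
    moreover have "(1/2 - E) * (E - 2/5) \<ge> 0" using E by simp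
    ultimately show ?thesis by linarith
  qed
  have E2': "E\<^sup>2 \<le> 1/4" using power_mono[of E "1/2" 2] E by (simp add: power2_eq_square)
  \<comment> \<open>Each coefficient is paired with its own denominator; clearing denominators below
    then reduces to polynomial identities.\<close>
  have K1: "K * (1 - \<tau>) = 3 - 3 * \<tau> + \<tau>\<^sup>2"
    using \<tau> by (simp add: K_def field_simps power2_eq_square)
  have a1: "a * (1 + \<tau>) = 2 + \<tau>" using \<tau> by (simp add: a_def)
  have b1: "b * (3 - \<tau>) = K * \<tau>" using \<tau> by (simp add: b_def)
  have c1: "c * (1 + \<tau>) = 1 - \<tau>" using \<tau> by (simp add: c_def)
  define w where "w = max (1 - 3/2 * \<tau>) E"
  have wq: "w \<le> q" using q by (simp add: w_def)
  have P: "(1 - \<tau>) * (3 - \<tau>) * (1 + \<tau>) > 0" using \<tau> by simp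
  have mono: "E * x - c * E + a * E\<^sup>2 * x - K * E ^ 3 + b * x \<le> E * y - c * E + a * E\<^sup>2 * y - K * E ^ 3 + b * y"
    if "x \<le> y" for x y
  proof -
    have "(E + a * E\<^sup>2 + b) * x \<le> (E + a * E\<^sup>2 + b) * y" using that a0 b0 E by (intro mult_left_mono) auto
    then show ?thesis by (simp add: distrib_right)
  qed
  have key: "0 \<le> E * w - c * E + a * E\<^sup>2 * w - K * E ^ 3 + b * w"
  \<comment> \<open>At \<tau> = 1/3 the difference \<open>v - c\<close> changes sign. Up to there
    the bound \<open>1 - 3/2 * \<tau>\<close> is used for \<open>w\<close>, beyond it the bound
    \<open>E\<close>.\<close>
  proof (cases "\<tau> \<le> 1/3")
    case True
    define v where "v = 1 - 3/2 * \<tau>"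
    have v: "v \<le> w" "v \<ge> 1/2" using True by (auto simp: v_def w_def)
    have "E * (v - c) \<ge> 0"
    proof -
      have "v - c = \<tau> * (1 - 3 * \<tau>) / (2 * (1 + \<tau>))"
        using \<tau> by (simp add: v_def c_def field_simps)
      then show ?thesis using True \<tau> E by simp
    qed
    \<comment> \<open>Since \<open>E \<le> 1/2\<close> and \<open>4 * E\<^sup>2 \<le> 1\<close>, the
      case E = 1/2, which is inequality 2 below, implies the others.\<close>
    moreover have "0 \<le> E\<^sup>2 * (a * v - K * E) + b * v"
    proof -
      have 1: "E\<^sup>2 * (a * v - K / 2) \<le> E\<^sup>2 * (a * v - K * E)"
        using mult_left_mono[OF E(2) K(1)] by (intro mult_left_mono) auto
      have 2: "0 \<le> (a * v - K / 2) / 4 + b * v"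
      proof -
        have eq: "((a * v - K / 2) / 4 + b * v) * ((1 - \<tau>) * (3 - \<tau>) * (1 + \<tau>)) =
          (2 + \<tau>) * v * (1 - \<tau>) * (3 - \<tau>) / 4 - (3 - 3 * \<tau> + \<tau>\<^sup>2) * (1 + \<tau>) * (3 - \<tau>) / 8
           + (3 - 3 * \<tau> + \<tau>\<^sup>2) * \<tau> * v * (1 + \<tau>)"
        proof -
          have "((a * v - K / 2) / 4 + b * v) * ((1 - \<tau>) * (3 - \<tau>) * (1 + \<tau>)) =
            (a * (1 + \<tau>)) * (v * (1 - \<tau>) * (3 - \<tau>) / 4) - (K * (1 - \<tau>)) * ((1 + \<tau>) * (3 - \<tau>) / 8)
             + (b * (3 - \<tau>)) * ((1 - \<tau>) * v * (1 + \<tau>))"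
            by (simp add: algebra_simps add_divide_distrib diff_divide_distrib)
          also have "\<dots> = (2 + \<tau>) * (v * (1 - \<tau>) * (3 - \<tau>) / 4) - (K * (1 - \<tau>)) * ((1 + \<tau>) * (3 - \<tau>) / 8)
             + (K * (1 - \<tau>)) * (\<tau> * v * (1 + \<tau>))"
            unfolding a1 b1 by (simp only: ac_simps)
          finally show ?thesis unfolding K1 by (simp only: ac_simps times_divide_eq_right times_divide_eq_left)
        qed
        have "0 \<le> (2 + \<tau>) * v * (1 - \<tau>) * (3 - \<tau>) / 4 - (3 - 3 * \<tau> + \<tau>\<^sup>2) * (1 + \<tau>) * (3 - \<tau>) / 8
           + (3 - 3 * \<tau> + \<tau>\<^sup>2) * \<tau> * v * (1 + \<tau>)"
        proof -
          have "\<tau>\<^sup>2 \<le> 1/9" using power_mono[OF True, of 2] \<tau> by (simp add: power2_eq_square)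
          moreover have "\<tau> ^ 3 \<le> 1/27" using power_mono[OF True, of 3] \<tau> by (simp add: power3_eq_cube)
          moreover have "\<tau> ^ 4 * (15/4 - 3/2 * \<tau>) \<ge> 0" using \<tau> by simp
          moreover have "(2 + \<tau>) * v * (1 - \<tau>) * (3 - \<tau>) / 4 - (3 - 3 * \<tau> + \<tau>\<^sup>2) * (1 + \<tau>) * (3 - \<tau>) / 8
             + (3 - 3 * \<tau> + \<tau>\<^sup>2) * \<tau> * v * (1 + \<tau>)
             = 3/8 - \<tau> / 8 - 19/8 * \<tau>\<^sup>2 - 13/8 * \<tau> ^ 3 + \<tau> ^ 4 * (15/4 - 3/2 * \<tau>)"
            unfolding v_def by (simp add: field_simps eval_nat_numeral)
          ultimately show ?thesis using True by linarith
        qed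
        then have "((a * v - K / 2) / 4 + b * v) * ((1 - \<tau>) * (3 - \<tau>) * (1 + \<tau>)) \<ge> 0" using eq by linarith
        then show ?thesis using P by (metis zero_le_mult_iff not_less)
      qed
      have "0 \<le> 4 * E\<^sup>2 * ((a * v - K / 2) / 4 + b * v)" using 2 by simp
      also have "\<dots> \<le> E\<^sup>2 * (a * v - K / 2) + b * v"
      proof -
        have "4 * E\<^sup>2 * (b * v) \<le> 1 * (b * v)" using E2' b0 v by (intro mult_right_mono) auto
        moreover have "4 * E\<^sup>2 * ((a * v - K / 2) / 4 + b * v) = E\<^sup>2 * (a * v - K / 2) + 4 * E\<^sup>2 * (b * v)"
          by (simp add: field_simps)
        ultimately show ?thesis by linarith
      qed
      finally show ?thesis using 1 by linarith
    qed
    ultimately have "0 \<le> E * v - c * E + a * E\<^sup>2 * v - K * E ^ 3 + b * v"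
      by (simp add: algebra_simps power2_eq_square power3_eq_cube)
    also have "\<dots> \<le> E * w - c * E + a * E\<^sup>2 * w - K * E ^ 3 + b * w"
      using v(1) by (rule mono)
    finally show ?thesis .
  next
    case False
    have 3: "0 \<le> E - c + b + E\<^sup>2 * (a - K)"
    proof -
      define m where "m = K - a"
      have m0: "m \<ge> 10/9" 
      proof -
        have "a \<le> 7/4" using False \<tau> by (simp add: a_def field_simps)
        moreover have "1 / (1 - \<tau>) \<ge> 3/2" using False \<tau> by (simp add: field_simps)
        then have "K \<ge> 3" using False \<tau> by (simp add: K_def)
        ultimately show ?thesis by (simp add: m_def)
      qed
      \<comment> \<open>Once \<open>E\<^sup>2\<close> is replaced by its chord, the expression is
        affine in \<open>E\<close> and, by \<open>m0\<close>, nonincreasing; this is its value at E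
        = 1/2.\<close>
      have "0 \<le> 1/2 - c + b - m / 4"
      proof -
        have "(1/2 - c + b - m / 4) * ((1 - \<tau>) * (3 - \<tau>) * (1 + \<tau>))
            = - 9/4 + 9 * \<tau> - 11/2 * \<tau>\<^sup>2 - 3/2 * (\<tau>\<^sup>2 * \<tau>) + 5/4 * \<tau> ^ 4"
        proof -
          have "(1/2 - c + b - m / 4) * ((1 - \<tau>) * (3 - \<tau>) * (1 + \<tau>))
            = (1 - \<tau>) * (3 - \<tau>) * (1 + \<tau>) / 2 - (c * (1 + \<tau>)) * ((1 - \<tau>) * (3 - \<tau>))
              + (b * (3 - \<tau>)) * ((1 - \<tau>) * (1 + \<tau>)) - (K * (1 - \<tau>)) * ((3 - \<tau>) * (1 + \<tau>)) / 4
              + (a * (1 + \<tau>)) * ((1 - \<tau>) * (3 - \<tau>)) / 4"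
            unfolding m_def by (simp add: algebra_simps add_divide_distrib diff_divide_distrib)
          also have "\<dots> = (1 - \<tau>) * (3 - \<tau>) * (1 + \<tau>) / 2 - (1 - \<tau>) * ((1 - \<tau>) * (3 - \<tau>))
              + (K * (1 - \<tau>)) * (\<tau> * (1 + \<tau>)) - (K * (1 - \<tau>)) * ((3 - \<tau>) * (1 + \<tau>)) / 4
              + (2 + \<tau>) * ((1 - \<tau>) * (3 - \<tau>)) / 4"
            unfolding a1 b1 c1 by (simp only: ac_simps)
          also have "\<dots> = - 9/4 + 9 * \<tau> - 11/2 * \<tau>\<^sup>2 - 3/2 * (\<tau>\<^sup>2 * \<tau>) + 5/4 * \<tau> ^ 4"
            unfolding K1 by (simp add: field_simps eval_nat_numeral)
          finally show ?thesis .
        qed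
        moreover have "\<tau>\<^sup>2 \<le> 5/6 * \<tau> - 1/6"
        proof -
          have "(1/2 - \<tau>) * (\<tau> - 1/3) = 5/6 * \<tau> - 1/6 - \<tau>\<^sup>2" by (simp add: field_simps power2_eq_square)
          moreover have "(1/2 - \<tau>) * (\<tau> - 1/3) \<ge> 0" using \<tau> False by simp
          ultimately show ?thesis by linarith
        qed
        moreover have "\<tau>\<^sup>2 * \<tau> \<le> 1/4 * \<tau>"
          using power_mono[of \<tau> "1/2" 2] \<tau> by (intro mult_right_mono) (auto simp: power2_eq_square)
        moreover have "\<tau> ^ 4 \<ge> 0" by simp
        ultimately have "(1/2 - c + b - m / 4) * ((1 - \<tau>) * (3 - \<tau>) * (1 + \<tau>)) \<ge> 0" using False by linarith
        then show ?thesis using P by (metis zero_le_mult_iff not_less)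
      qed
      moreover have "(E - 1/2) * (1 - 9/10 * m) \<ge> 0" using m0 E by (intro mult_nonpos_nonpos) auto
      moreover have "E\<^sup>2 * m \<le> (9/10 * E - 1/5) * m" using E2 m0 by (intro mult_right_mono) auto
      moreover have "(E - 1/2) * (1 - 9/10 * m) = E - 1/2 - (9/10 * E - 1/5) * m + m / 4"
        by (simp add: field_simps)
      moreover have "E\<^sup>2 * (a - K) = - (E\<^sup>2 * m)" by (simp add: m_def algebra_simps)
      ultimately show ?thesis by linarith
    qed
    have "0 \<le> E * (E - c + b + E\<^sup>2 * (a - K))" using 3 E by simp
    also have "\<dots> = E * E - c * E + a * E\<^sup>2 * E - K * E ^ 3 + b * E"
      by (simp add: algebra_simps power2_eq_square power3_eq_cube)
    also have "\<dots> \<le> E * w - c * E + a * E\<^sup>2 * w - K * E ^ 3 + b * w"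
      by (rule mono) (simp add: w_def)
    finally show ?thesis .
  qed
  also have "\<dots> \<le> E * q - c * E + a * E\<^sup>2 * q - K * E ^ 3 + b * q"
    using wq by (rule mono)
  also have "\<dots> = E * q - (E - E\<^sup>2 * q * ((2 + \<tau>) / (1 - \<tau>))) * c - K * (E ^ 3 - \<tau> / (3 - \<tau>) * q)"
  proof -
    have "((2 + \<tau>) / (1 - \<tau>)) * c = a" using \<tau> by (simp add: c_def a_def)
    then have "E\<^sup>2 * q * ((2 + \<tau>) / (1 - \<tau>)) * c = a * E\<^sup>2 * q"
      by (metis mult.assoc mult.commute)
    then show ?thesis unfolding left_diff_distrib right_diff_distrib by (simp add: b_def)
  qed
  finally show ?thesis by (simp add: K_def c_def)
qed


text \<open>
  Below, \<open>\<tau> = 3 * s\<close>, and \<open>x1, b, b', a', a, x2\<close> stand for the values of the primitive \<open>F\<close> at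
  \<open>s, 1/3 - s, 1/3 + s, 2/3 - s, 2/3 + s, 1 - s\<close>, while \<open>t = F (1/3)\<close>. The hypotheses named \<open>h\<close>
  are the segment inequalities. In the conclusion the weights \<open>exp (- L * \<sigma>)\<close> are multiplied by
  \<open>exp (- L * s)\<close>, which makes them polynomial in \<open>E = exp (- L / 3)\<close> and \<open>q = exp (- 2 * L * s)\<close>.
\<close>

lemma orbit_bound:
  fixes \<tau> E q x1 x2 a b a' b' t :: real
  assumes \<tau>: "0 < \<tau>" "\<tau> < 1/2" and E: "23/50 \<le> E" "E \<le> 1/2"
    and q: "1 - 3/2 * \<tau> \<le> q" "E \<le> q" "q \<le> 1 - 2 * \<tau> * (1 - E)"
    and t: "t \<le> 0"
    and h1: "(3 - \<tau>) * x1 + \<tau> * x2 \<le> 0"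
    and hR: "(1 - \<tau>) * a + (2 + \<tau>) * b \<le> 0"
    and h2: "(1 + \<tau>) * b + (1 - \<tau>) * b' \<le> 0"
    and h4: "t + (t - x1) / (1 - \<tau>) + (x2 - t) / (2 - \<tau>) \<le> 0"
    and h6: "(1 - \<tau>) / (2 - \<tau>) * a' \<le> \<tau> / (1 + \<tau>) * b'"
    and h7: "b' \<le> b"
    and h8: "(1 - \<tau>) * b' + \<tau> * a' \<le> t * (1 - \<tau> + \<tau>\<^sup>2)"
  shows "q * x1 + E ^ 3 * x2 + E * b + E * q * b' + E\<^sup>2 * q * a + E\<^sup>2 * a' \<le> 0"
proof -
  have q01: "0 \<le> q" "q \<le> 1"
    using q E \<tau> mult_nonneg_nonneg[of "2 * \<tau>" "1 - E"] by linarith+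
  have E2: "E\<^sup>2 \<ge> 1/5" using power_mono[OF E(1), of 2] by (simp add: power2_eq_square)
  have E3: "E ^ 3 \<ge> 9/100" using power_mono[OF E(1), of 3] by (simp add: power3_eq_cube)
  have qE: "\<tau> * q \<le> E * (1 - \<tau>)"
  proof -
    have "\<tau> * q \<le> \<tau> * (1 - 2 * \<tau> * (1 - E))" using q \<tau> by simp
    moreover have "E * (1 - \<tau>) - \<tau> * (1 - 2 * \<tau> * (1 - E)) = (1 - 2 * \<tau>) * (E * (1 + \<tau>) - \<tau>)"
      by (simp add: algebra_simps)
    moreover have "E * (1 + \<tau>) - \<tau> \<ge> 0"
    proof -
      have "E * (1 + \<tau>) \<ge> 2/5 * (1 + \<tau>)" using E \<tau> by (intro mult_right_mono) auto
      then show ?thesis using \<tau> by simp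
    qed
    then have "(1 - 2 * \<tau>) * (E * (1 + \<tau>) - \<tau>) \<ge> 0" using \<tau> by simp
    ultimately show ?thesis by linarith
  qed
  have d: "\<tau> * q \<le> (3 - \<tau>) * E ^ 3"
  proof -
    have "\<tau> * q \<le> \<tau> * (1 - 2 * \<tau> * (1 - E))" using q \<tau> by simp
    \<comment> \<open>The last summand is the value at \<tau> = 1/2, nonnegative because
      \<open>E\<^sup>2 \<ge> 1/5\<close>; the rest is divisible by 1/2 - \<tau>.\<close>
    moreover have "(3 - \<tau>) * E ^ 3 - \<tau> * (1 - 2 * \<tau> * (1 - E))
      = (1/2 - \<tau>) * (E ^ 3 + 1 - 2 * (1 - E) * (\<tau> + 1/2)) + E * (5/2 * E\<^sup>2 - 1/2)"
      by (simp add: field_simps power2_eq_square power3_eq_cube)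
    moreover have "(1/2 - \<tau>) * (E ^ 3 + 1 - 2 * (1 - E) * (\<tau> + 1/2)) \<ge> 0"
    proof (intro mult_nonneg_nonneg)
      have "2 * (1 - E) * (\<tau> + 1/2) \<le> 2 * (1 - E) * 1" using \<tau> E by (intro mult_left_mono) auto
      also have "\<dots> \<le> E ^ 3 + 1" using E3 E by simp
      finally show "0 \<le> E ^ 3 + 1 - 2 * (1 - E) * (\<tau> + 1/2)" by simp
    qed (use \<tau> in simp)
    moreover have "E * (5/2 * E\<^sup>2 - 1/2) \<ge> 0" using E E2 by simp
    ultimately show ?thesis by linarith
  qed
  define \<kappa> where "\<kappa> = (2 - \<tau> + 1 / (1 - \<tau>)) * (E ^ 3 - \<tau> / (3 - \<tau>) * q)"
  have \<kappa>0: "\<kappa> \<ge> 0"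
  proof -
    have "2 - \<tau> + 1 / (1 - \<tau>) \<ge> 0" using \<tau> by simp
    moreover have "E ^ 3 - \<tau> / (3 - \<tau>) * q \<ge> 0" using d \<tau> by (simp add: field_simps)
    ultimately show ?thesis by (simp add: \<kappa>_def)
  qed
  have low: "q * x1 + E ^ 3 * x2 \<le> \<kappa> * (- t)"
    unfolding \<kappa>_def using low_pair_bound[OF \<tau> t d q01(1) h1 h4] .
  \<comment> \<open>\<open>hR\<close> eliminates \<open>a\<close>, and \<delta> is the resulting
    coefficient of \<open>b\<close>.\<close>
  define \<delta> where "\<delta> = E - E\<^sup>2 * q * ((2 + \<tau>) / (1 - \<tau>))"
  have "a \<le> - ((2 + \<tau>) / (1 - \<tau>)) * b" using hR \<tau> by (simp add: field_simps)
  then have "E\<^sup>2 * q * a \<le> E\<^sup>2 * q * (- ((2 + \<tau>) / (1 - \<tau>)) * b)"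
    using q01 by (intro mult_left_mono) auto
  then have mid: "E * b + E\<^sup>2 * q * a \<le> \<delta> * b" by (simp add: \<delta>_def left_diff_distrib)
  \<comment> \<open>Next \<open>b\<close> is eliminated, by \<open>h7\<close> if \<delta> is
    nonpositive and by \<open>h2\<close> otherwise; \<open>r\<close> is the coefficient then left on
    \<open>b'\<close>. Since \<kappa> is at most \<open>r\<close>, the bound \<open>r * t\<close>
    for the high pair compensates \<open>\<kappa> * (- t)\<close> from \<open>low\<close>.\<close>
  obtain r where r: "\<delta> * b \<le> (r - E * q) * b'" "\<kappa> \<le> r" "r \<le> E * q"
  proof (cases "\<delta> \<le> 0")
    case True
    show thesis
    proof (rule that[of "E * q + \<delta>"])
      show "\<delta> * b \<le> (E * q + \<delta> - E * q) * b'" using mult_left_mono_neg[OF h7 True] by simp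
      show "\<kappa> \<le> E * q + \<delta>" unfolding \<kappa>_def \<delta>_def using margin_neg[OF \<tau> _ E(2) q01] E by simp
      show "E * q + \<delta> \<le> E * q" using True by simp
    qed
  next
    case False
    show thesis
    proof (rule that[of "E * q - \<delta> * ((1 - \<tau>) / (1 + \<tau>))"])
      have "b \<le> - ((1 - \<tau>) / (1 + \<tau>)) * b'" using h2 \<tau> by (simp add: field_simps)
      then have "\<delta> * b \<le> \<delta> * (- ((1 - \<tau>) / (1 + \<tau>)) * b')" using False by (intro mult_left_mono) auto
      then show "\<delta> * b \<le> (E * q - \<delta> * ((1 - \<tau>) / (1 + \<tau>)) - E * q) * b'" by simp
      show "\<kappa> \<le> E * q - \<delta> * ((1 - \<tau>) / (1 + \<tau>))"
        unfolding \<kappa>_def \<delta>_def using margin_pos[OF \<tau> _ E(2) q(1,2)] E by simp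
      show "E * q - \<delta> * ((1 - \<tau>) / (1 + \<tau>)) \<le> E * q" using False \<tau> by simp
    qed
  qed
  have "r * b' + E\<^sup>2 * a' \<le> r * t"
  proof (rule high_pair_bound[OF \<tau> t _ _ h6 h8])
    show "0 \<le> r" using r \<kappa>0 by simp
    have "r * \<tau> \<le> E * (\<tau> * q)" using mult_right_mono[OF r(3), of \<tau>] \<tau> by (simp add: ac_simps)
    also have "\<dots> \<le> E * (E * (1 - \<tau>))" using qE E by (intro mult_left_mono) auto
    finally show "r * \<tau> \<le> E\<^sup>2 * (1 - \<tau>)" by (simp add: power2_eq_square ac_simps)
  qed
  moreover have "r * t \<le> \<kappa> * t" using r(2) t by (intro mult_right_mono_neg)
  ultimately show ?thesis using low mid r(1) by (simp add: left_diff_distrib)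
qed

subsection \<open>Exponential weights\<close>

text \<open>The hypothesis \<open>mean\<close> says that the density proportional to
  \<open>exp (- L * x)\<close> on the unit interval has mean 1/3, the average of three coordinates
  with sum 1.\<close>

lemma exp_weight_orthogonal_affine:
  fixes L :: real
  assumes L: "L > 0" and mean: "exp (- L) * (3 + 2 * L) = 3 - L"
  shows "((\<lambda>x. (x - 1/3) * exp (- L * x)) has_integral 0) {0..1}"
proof -
  define G where "G = (\<lambda>x. - ((x - 1/3) / L + 1 / L\<^sup>2) * exp (- L * x))"
  have "((\<lambda>x. (x - 1/3) * exp (- L * x)) has_integral G 1 - G 0) {0..1}"
  proof (rule fundamental_theorem_of_calculus)
    fix x :: real
    have "(G has_real_derivative (x - 1/3) * exp (- L * x)) (at x within {0..1})"
      unfolding G_def using L by (auto intro!: derivative_eq_intros simp: field_simps power2_eq_square)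
    then show "(G has_vector_derivative (x - 1/3) * exp (- L * x)) (at x within {0..1})"
      by (simp add: has_real_derivative_iff_has_vector_derivative)
  qed simp
  moreover have "G 1 - G 0 = ((3 - L) - exp (- L) * (3 + 2 * L)) / (3 * L\<^sup>2)"
    using L unfolding G_def by (simp add: field_simps power2_eq_square)
  ultimately show ?thesis using mean by simp
qed

text \<open>Tangent of exp at 0, monotonicity, and the chord of exp between 0 and
  \<open>- L / 3\<close> taken at the weight \<open>6 * s\<close>.\<close>

lemma exp_weight_bounds:
  fixes L s :: real
  assumes L: "L \<le> 9/4" "0 \<le> L" and s: "0 \<le> s" "s \<le> 1/6"
  defines "E \<equiv> exp (- L / 3)" and "q \<equiv> exp (- 2 * L * s)"
  shows "1 - 3/2 * (3 * s) \<le> q" "E \<le> q" "q \<le> 1 - 2 * (3 * s) * (1 - E)"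
proof -
  have "1 + (- 2 * L * s) \<le> q" unfolding q_def by (rule exp_ge_add_one_self)
  moreover have "L * s \<le> 9/4 * s" using L s by (intro mult_right_mono) auto
  ultimately show "1 - 3/2 * (3 * s) \<le> q" by simp
  have "L * s \<le> L * (1/6)" using L s by (intro mult_left_mono) auto
  then show "E \<le> q" by (simp add: E_def q_def)
  have "exp ((1 - 6 * s) *\<^sub>R 0 + (6 * s) *\<^sub>R (- L / 3)) \<le> (1 - 6 * s) * exp 0 + (6 * s) * exp (- L / 3)"
    using exp_convex s by (intro convex_onD[of UNIV exp]) auto
  then show "q \<le> 1 - 2 * (3 * s) * (1 - E)"
    by (simp add: q_def E_def algebra_simps)
qed

lemma add_divide_mult_clear:
  fixes a b x y k :: real
  assumes "x \<noteq> 0" "y \<noteq> 0"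
  shows "(a / x + b / y) * (k * (x * y)) = k * a * y + k * b * x"
  using assms by (simp add: field_simps)

text \<open>Every hypothesis of \<open>orbit_bound\<close> comes from a segment whose end points
  have coordinates among 0, 1, 1/3 and the six orbit points, after clearing denominators and using
  \<open>F 0 = F 1 = 0\<close>.\<close>

lemma exp_orbit_le_0:
  fixes f :: "real \<Rightarrow> real" and L s :: real
  assumes f: "f integrable_on {0..1}"
    and tri: "\<And>a b c. a \<in> {0..1} \<Longrightarrow> b \<in> {0..1} \<Longrightarrow> c \<in> {0..1} \<Longrightarrow> a + b + c = 1 \<Longrightarrow> f a + f b + f c \<le> 0"
    and L: "0 \<le> L" "L \<le> 9/4" "23/50 \<le> exp (- L / 3)" "exp (- L / 3) \<le> 1/2"
    and s: "0 < s" "s < 1/6"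
  defines "F \<equiv> \<lambda>x. integral {0..x} f"
  assumes F1: "F 1 = 0"
  defines "g \<equiv> \<lambda>x. F x * exp (- L * x)"
  shows "g s + g (1/3 - s) + g (1/3 + s) + g (2/3 - s) + g (2/3 + s) + g (1 - s) \<le> 0"
proof -
  have Fi: "integral {0..x} f = F x" for x by (simp add: F_def)
  note seg = triple_segment_le_0[OF f tri, unfolded Fi]
  have F0: "F 0 = 0" by (simp add: F_def)
  define \<tau> where "\<tau> = 3 * s"
  have s_eq: "s = \<tau> / 3" by (simp add: \<tau>_def)
  have \<tau>: "0 < \<tau>" "\<tau> < 1/2" using s by (auto simp: \<tau>_def)
  define E where "E = exp (- L / 3)"
  define q where "q = exp (- 2 * L * s)"
  define z where "z = exp (- L * s)"
  define t where "t = F (1/3)"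
  define x1 where "x1 = F s"
  define x2 where "x2 = F (1 - s)"
  define b where "b = F (1/3 - s)"
  define b' where "b' = F (1/3 + s)"
  define a where "a = F (2/3 + s)"
  define a' where "a' = F (2/3 - s)"
  note defs = t_def[symmetric] x1_def[symmetric] x2_def[symmetric] b_def[symmetric] b'_def[symmetric] a_def[symmetric] a'_def[symmetric]
  have t: "t \<le> 0"
    using seg[of 0 0 1 "1/3" "1/3" "1/3"] by (simp add: F0 F1 t_def)
  have "x1 / s + x2 / (1 - s) \<le> 0"
    using seg[of 0 1 0 s 0 "1 - s"] s by (simp add: F0 F1 x1_def x2_def)
  then have "(x1 / s + x2 / (1 - s)) * (3 * (s * (1 - s))) \<le> 0" using s by (simp add: mult_nonpos_nonneg)
  moreover have "(x1 / s + x2 / (1 - s)) * (3 * (s * (1 - s))) = (3 - \<tau>) * x1 + \<tau> * x2"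
    using s by (simp add: \<tau>_def field_simps)
  ultimately have h1: "(3 - \<tau>) * x1 + \<tau> * x2 \<le> 0" by simp
  have "b / (1/3 - s) + a / (2/3 + s) \<le> 0"
    using seg[of 0 1 0 "1/3 - s" 0 "2/3 + s"] s by (simp add: F0 F1 b_def a_def)
  then have "(b / (1/3 - s) + a / (2/3 + s)) * (3 * ((1/3 - s) * (2/3 + s))) \<le> 0" using s by (simp add: mult_nonpos_nonneg)
  moreover have "(b / (1/3 - s) + a / (2/3 + s)) * (3 * ((1/3 - s) * (2/3 + s))) = (1 - \<tau>) * a + (2 + \<tau>) * b"
    using s by (subst add_divide_mult_clear) (auto simp: \<tau>_def algebra_simps)
  ultimately have hR: "(1 - \<tau>) * a + (2 + \<tau>) * b \<le> 0" by simp
  have "b / (1/3 - s) + b' / (1/3 + s) - 3/2 * t \<le> 0"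
    using seg[of 0 0 1 "1/3 - s" "1/3 + s" "1/3"] s by (simp add: F0 F1 b_def b'_def t_def)
  then have "b / (1/3 - s) + b' / (1/3 + s) \<le> 0" using t by linarith
  then have "(b / (1/3 - s) + b' / (1/3 + s)) * (3 * ((1/3 - s) * (1/3 + s))) \<le> 0" using s by (simp add: mult_nonpos_nonneg)
  moreover have "(b / (1/3 - s) + b' / (1/3 + s)) * (3 * ((1/3 - s) * (1/3 + s))) = (1 + \<tau>) * b + (1 - \<tau>) * b'"
    using s by (subst add_divide_mult_clear) (auto simp: \<tau>_def algebra_simps)
  ultimately have h2: "(1 + \<tau>) * b + (1 - \<tau>) * b' \<le> 0" by simp
  have "3 * t + (t - x1) / (1/3 - s) + (t - x2) / (1/3 - (1 - s)) \<le> 0"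
    using seg[of 0 s "1 - s" "1/3" "1/3" "1/3"] s by (simp add: F0 t_def x1_def x2_def)
  moreover have "(t - x1) / (1/3 - s) = 3 * ((t - x1) / (1 - \<tau>))" "(t - x2) / (1/3 - (1 - s)) = 3 * ((x2 - t) / (2 - \<tau>))"
    using \<tau> by (simp_all add: s_eq field_simps)
  ultimately have h4: "t + (t - x1) / (1 - \<tau>) + (x2 - t) / (2 - \<tau>) \<le> 0" by linarith
  have "b' / (1/3 + s) + a' / (2/3 - s) + (a' - b') / (1/3 - 2 * s) \<le> 0"
  proof -
    have "F (2/3 - s) / (s - 2/3) = - (F (2/3 - s) / (2/3 - s))" by (metis minus_diff_eq minus_divide_right)
    then show ?thesis using seg[of 0 "2/3 - s" "1/3 + s" "1/3 + s" 0 "2/3 - s"] s by (simp add: F0 a'_def b'_def)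
  qed
  then have "(b' / (1/3 + s) + a' / (2/3 - s) + (a' - b') / (1/3 - 2 * s)) * ((1 - 2 * \<tau>) / 9) \<le> 0"
    using \<tau> by (simp add: mult_nonpos_nonneg)
  moreover have "(b' / (1/3 + s) + a' / (2/3 - s) + (a' - b') / (1/3 - 2 * s)) * ((1 - 2 * \<tau>) / 9)
     = (1 - \<tau>) / (2 - \<tau>) * a' - \<tau> / (1 + \<tau>) * b'"
  proof -
    have e1: "b' / (1/3 + s) = 3 * b' / (1 + \<tau>)" and e2: "a' / (2/3 - s) = 3 * a' / (2 - \<tau>)"
      and e3: "(a' - b') / (1/3 - 2 * s) = 3 * (a' - b') / (1 - 2 * \<tau>)"
      using \<tau> by (simp_all add: s_eq field_simps)
    have r1: "(b' / (1/3 + s) + a' / (2/3 - s) + (a' - b') / (1/3 - 2 * s)) * ((1 - 2 * \<tau>) / 9)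
      = b' * ((1 - 2 * \<tau>) / (1 + \<tau>)) / 3 + a' * ((1 - 2 * \<tau>) / (2 - \<tau>)) / 3 + (a' - b') / 3"
    proof -
      have *: "(3 * x / P + 3 * y / Q + 3 * w / R) * (R / 9) = x * (R / P) / 3 + y * (R / Q) / 3 + w / 3"
        if "P \<noteq> 0" "Q \<noteq> 0" "R \<noteq> 0" for x y w P Q R :: real
        using that by (simp add: field_simps)
      show ?thesis unfolding e1 e2 e3 using \<tau> by (intro *) auto
    qed
    have r2: "(1 - 2 * \<tau>) / (1 + \<tau>) = 1 - 3 * (\<tau> / (1 + \<tau>))"
      and r3: "(1 - 2 * \<tau>) / (2 - \<tau>) = 3 * ((1 - \<tau>) / (2 - \<tau>)) - 1"
      using \<tau> by (simp_all add: field_simps)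
    have "b' * (1 - 3 * X) / 3 + a' * (3 * Y - 1) / 3 + (a' - b') / 3 = Y * a' - X * b'" for X Y :: real
      by (simp add: field_simps)
    then show ?thesis unfolding r1 r2 r3 .
  qed
  ultimately have h6: "(1 - \<tau>) / (2 - \<tau>) * a' \<le> \<tau> / (1 + \<tau>) * b'" by linarith
  \<comment> \<open>The end points of this segment are cyclic shifts of each other, so the value at
    1/3 cancels.\<close>
  have "(t - b) / s + (b' - t) / s + (b - b') / (1/3 - s - (1/3 + s)) \<le> 0"
    using seg[of "1/3 - s" "1/3" "1/3 + s" "1/3" "1/3 + s" "1/3 - s"] s by (simp add: t_def b_def b'_def)
  moreover have "(t - b) / s + (b' - t) / s + (b - b') / (1/3 - s - (1/3 + s)) = 3/2 * ((b' - b) / s)"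
    using s by (simp add: field_simps)
  ultimately have "(b' - b) / s \<le> 0" by linarith
  then have h7: "b' \<le> b" using s by (simp add: divide_le_0_iff)
  have "3 * t + (t - b') / (1/3 - (1/3 + s)) + (t - a') / (1/3 - (2/3 - s)) \<le> 0"
    using seg[of 0 "1/3 + s" "2/3 - s" "1/3" "1/3" "1/3"] s by (simp add: F0 t_def a'_def b'_def)
  moreover have "(t - b') / (1/3 - (1/3 + s)) = 3 * ((b' - t) / \<tau>)" "(t - a') / (1/3 - (2/3 - s)) = 3 * ((a' - t) / (1 - \<tau>))"
    using \<tau> by (simp_all add: s_eq field_simps)
  ultimately have "t + (b' - t) / \<tau> + (a' - t) / (1 - \<tau>) \<le> 0" by linarith
  then have "(t + (b' - t) / \<tau> + (a' - t) / (1 - \<tau>)) * (\<tau> * (1 - \<tau>)) \<le> 0"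
    using \<tau> by (simp add: mult_nonpos_nonneg)
  moreover have "(t + (b' - t) / \<tau> + (a' - t) / (1 - \<tau>)) * (\<tau> * (1 - \<tau>))
     = (1 - \<tau>) * b' + \<tau> * a' - t * (1 - \<tau> + \<tau>\<^sup>2)"
    using \<tau> by (simp add: divide_simps) (simp add: algebra_simps power2_eq_square)
  ultimately have h8: "(1 - \<tau>) * b' + \<tau> * a' \<le> t * (1 - \<tau> + \<tau>\<^sup>2)" by linarith
  have qb: "1 - 3/2 * \<tau> \<le> q" "E \<le> q" "q \<le> 1 - 2 * \<tau> * (1 - E)"
    unfolding q_def E_def \<tau>_def using exp_weight_bounds[of L s] L s by auto
  have main: "q * x1 + E ^ 3 * x2 + E * b + E * q * b' + E\<^sup>2 * q * a + E\<^sup>2 * a' \<le> 0"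
    using L by (intro orbit_bound[OF \<tau> _ _ qb t h1 hR h2 h4 h6 h7 h8]) (auto simp: E_def)
  have e: "exp (- L * s) * z = q" "exp (- L * (1 - s)) * z = E ^ 3" "exp (- L * (1/3 - s)) * z = E"
    "exp (- L * (1/3 + s)) * z = E * q" "exp (- L * (2/3 + s)) * z = E\<^sup>2 * q" "exp (- L * (2/3 - s)) * z = E\<^sup>2"
    unfolding E_def z_def q_def by (simp_all add: power2_eq_square power3_eq_cube field_simps flip: exp_add)
  have "(g s + g (1/3 - s) + g (1/3 + s) + g (2/3 - s) + g (2/3 + s) + g (1 - s)) * z
     = x1 * (exp (- L * s) * z) + b * (exp (- L * (1/3 - s)) * z) + b' * (exp (- L * (1/3 + s)) * z)
      + a' * (exp (- L * (2/3 - s)) * z) + a * (exp (- L * (2/3 + s)) * z) + x2 * (exp (- L * (1 - s)) * z)"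
    unfolding g_def defs by (simp only: distrib_right mult.assoc)
  also have "\<dots> = q * x1 + E ^ 3 * x2 + E * b + E * q * b' + E\<^sup>2 * q * a + E\<^sup>2 * a'"
    unfolding e by (simp add: algebra_simps)
  finally have "(g s + g (1/3 - s) + g (1/3 + s) + g (2/3 - s) + g (2/3 + s) + g (1 - s)) * z \<le> 0"
    using main by simp
  then show ?thesis by (simp add: z_def mult_le_0_iff)
qed

text \<open>
  The weight annihilates \<open>x - 1/3\<close>, and adding a multiple of it to \<open>f\<close> preserves the hypothesis on
  triples, so one may assume that \<open>f\<close> has integral zero.
\<close>

lemma exp_weighted_integral_le_0:
  fixes f :: "real \<Rightarrow> real" and L :: real
  assumes f: "f absolutely_integrable_on {0..1}"
    and tri: "\<And>a b c. a \<in> {0..1} \<Longrightarrow> b \<in> {0..1} \<Longrightarrow> c \<in> {0..1} \<Longrightarrow> a + b + c = 1 \<Longrightarrow> f a + f b + f c \<le> 0"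
    and L: "0 < L" "L \<le> 9/4" "23/50 \<le> exp (- L / 3)" "exp (- L / 3) \<le> 1/2"
    and mean: "exp (- L) * (3 + 2 * L) = 3 - L"
  shows "integral {0..1} (\<lambda>x. f x * exp (- L * x)) \<le> 0"
proof -
  \<comment> \<open>The function x - 1/3 has integral 1/6, so this \<open>k\<close> gives
    \<open>h\<close> integral zero.\<close>
  define k where "k = 6 * integral {0..1} f"
  define h where "h = (\<lambda>x. f x - k * (x - 1/3))"
  have ai: "(\<lambda>x. k * (x - 1/3)) absolutely_integrable_on {0..1}"
    by (intro absolutely_integrable_continuous_real continuous_intros)
  have h: "h absolutely_integrable_on {0..1}"
    unfolding h_def using set_integral_diff(1)[OF f ai] .
  have fi: "f integrable_on {0..1}" and hi: "h integrable_on {0..1}"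
    using f h by (auto simp: absolutely_integrable_on_def)
  have htri: "h a + h b + h c \<le> 0" if "a \<in> {0..1}" "b \<in> {0..1}" "c \<in> {0..1}" "a + b + c = 1" for a b c
  proof -
    have "h a + h b + h c = f a + f b + f c - k * (a + b + c - 1)" by (simp add: h_def algebra_simps)
    then show ?thesis using tri that by simp
  qed
  have "((\<lambda>x::real. x - 1/3) has_integral (1/6)) {0..1}"
  proof -
    have "((\<lambda>x::real. x - 1/3) has_integral (1\<^sup>2 / 2 - 1/3 * 1) - (0\<^sup>2 / 2 - 1/3 * 0)) {0..1}"
      by (rule fundamental_theorem_of_calculus)
         (auto intro!: derivative_eq_intros simp flip: has_real_derivative_iff_has_vector_derivative)
    then show ?thesis by simp
  qed
  from has_integral_diff[OF integrable_integral[OF fi] has_integral_mult_right[OF this, of k]]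
  have h1: "integral {0..1} h = 0" unfolding h_def by (intro integral_unique) (simp add: k_def)
  define F where "F = (\<lambda>x. integral {0..x} h)"
  have cF: "continuous_on {0..1} F" unfolding F_def by (rule indefinite_integral_continuous_1[OF hi])
  have "integral {0..1} (\<lambda>x. h x * exp (- L * x)) = F 1 * exp (- L * 1) - integral {0..1} (\<lambda>x. F x * (- L * exp (- L * x)))"
    unfolding F_def
    by (rule integral_mult_by_parts[OF h]) (auto intro!: derivative_eq_intros continuous_intros)
  also have "\<dots> = L * integral {0..1} (\<lambda>x. F x * exp (- L * x))"
    using h1 by (simp add: F_def flip: integral_mult_right) (simp add: ac_simps)
  also have "\<dots> \<le> 0"
  proof -
    have "integral {0..1} (\<lambda>x. F x * exp (- L * x)) \<le> 0"
    proof (rule integral_orbits_le_0)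
      show "(\<lambda>x. F x * exp (- L * x)) integrable_on {0..1}"
        by (intro integrable_continuous_real continuous_intros cF)
    next
      fix s :: real assume "0 < s" "s < 1/6"
      then show "F s * exp (- L * s) + F (1/3 - s) * exp (- L * (1/3 - s)) + F (1/3 + s) * exp (- L * (1/3 + s))
        + F (2/3 - s) * exp (- L * (2/3 - s)) + F (2/3 + s) * exp (- L * (2/3 + s)) + F (1 - s) * exp (- L * (1 - s)) \<le> 0"
        unfolding F_def using L h1 by (intro exp_orbit_le_0[OF hi htri]) auto
    qed
    then show ?thesis using L by (simp add: mult_nonneg_nonpos)
  qed
  finally have 1: "integral {0..1} (\<lambda>x. h x * exp (- L * x)) \<le> 0" .
  have hw: "(\<lambda>x. h x * exp (- L * x)) integrable_on {0..1}"
  proof -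
    have "(\<lambda>x. exp (- L * x) * h x) absolutely_integrable_on {0..1}"
      using h by (intro absolutely_integrable_bounded_measurable_product_real)
        (auto intro!: continuous_imp_measurable_on_sets_lebesgue compact_imp_bounded compact_continuous_image continuous_intros)
    then show ?thesis by (simp add: absolutely_integrable_on_def mult.commute)
  qed
  from has_integral_add[OF integrable_integral[OF hw] has_integral_mult_right[OF exp_weight_orthogonal_affine[OF L(1) mean], of k]]
  have "((\<lambda>x. f x * exp (- L * x)) has_integral integral {0..1} (\<lambda>x. h x * exp (- L * x))) {0..1}"
    by (simp add: h_def algebra_simps)
  then show ?thesis using 1 by (simp add: integral_unique)
qed

subsection \<open>Feasibility of the dual potential\<close>

lemma cl_root: "0 < cl" "cl < 1/4" "9 * cl + ln (1 - 2 * cl) - ln cl - 3 = 0"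
  using theI'[OF cl_ex1] unfolding cl_def[symmetric] by auto

text \<open>At t = 1/12 and t = 1/10 the quotient (1 - 2t)/t is 10 and 8, so the signs of the
  defining function of \<open>cl\<close> there amount to ln 10 > 9/4 and ln 8 < 21/10.\<close>

lemma ln_10_gt: "ln 10 > (9/4::real)"
proof -
  have "exp (9/4 :: real) ^ 4 = exp 1 ^ 9"
    by (simp add: exp_of_nat_mult[symmetric] flip: exp_of_nat_mult)
  also have "\<dots> \<le> (272/100) ^ 9"
    using e_less_272 by (intro power_mono) auto
  also have "\<dots> < 10 ^ 4" by (simp add: eval_nat_numeral)
  finally have "exp (9/4 :: real) < 10" by (rule power_less_imp_less_base) simp
  then have "ln (exp (9/4 :: real)) < ln 10" by (subst ln_less_cancel_iff) auto
  then show ?thesis by simp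
qed

lemma ln_8_lt: "ln 8 < (21/10::real)"
proof -
  have "ln (8::real) = 3 * ln 2" using ln_realpow[of "2::real" 3] by simp
  then show ?thesis using ln2_le_25_over_36 by simp
qed

text \<open>The defining function is convex on (0, 1/4], positive at 1/12 and negative at 1/10 and
  1/4. A root below 1/12 would make it nonpositive at 1/12, and between 1/10 and 1/4 it stays
  negative.\<close>

lemma cl_bounds: "1/12 < cl" "cl < 1/10"
proof -
  define F where "F = (\<lambda>t::real. 9 * t + ln (1 - 2 * t) - ln t - 3)"
  have cvx: "convex_on {0<..1/4} F"
  proof (rule f''_ge0_imp_convex)
    fix x :: real assume x: "x \<in> {0<..1/4}"
    show "(F has_real_derivative (9 - 2 / (1 - 2 * x) - 1 / x)) (at x)"
      unfolding F_def using x by (auto intro!: derivative_eq_intros simp: divide_simps)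
    show "((\<lambda>x. 9 - 2 / (1 - 2 * x) - 1 / x) has_real_derivative (1 / x\<^sup>2 - 4 / (1 - 2 * x)\<^sup>2)) (at x)"
      using x by (auto intro!: derivative_eq_intros simp: power2_eq_square)
    have "4 / (1 - 2 * x)\<^sup>2 \<le> 4 / (2 * x)\<^sup>2"
      using x by (intro divide_left_mono power_mono mult_pos_pos) auto
    then show "0 \<le> 1 / x\<^sup>2 - 4 / (1 - 2 * x)\<^sup>2" using x by (simp add: power2_eq_square)
  qed simp
  have F12: "F (1/12) > 0"
  proof -
    have "ln (1 - 2 * (1/12::real)) - ln (1/12) = ln ((10/12) / (1/12))" by (subst ln_div) simp_all
    then show ?thesis using ln_10_gt by (simp add: F_def)
  qed
  have F10: "F (1/10) < 0"
  proof -
    have "ln (1 - 2 * (1/10::real)) - ln (1/10) = ln ((8/10) / (1/10))" by (subst ln_div) simp_all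
    then show ?thesis using ln_8_lt by (simp add: F_def)
  qed
  have F4: "F (1/4) < 0"
  proof -
    have "ln (1/4::real) = - 2 * ln 2" using ln_realpow[of "2::real" 2] by (simp add: ln_div)
    then show ?thesis using ln2_le_25_over_36 by (simp add: F_def ln_div)
  qed
  have Fl: "F cl = 0" using cl_root by (simp add: F_def)
  have mid: "F y \<le> max (F x) (F z)" if "0 < x" "x \<le> y" "y \<le> z" "z \<le> 1/4" for x y z
  proof -
    have "{x..z} \<subseteq> {0<..1/4}" using that by auto
    from convex_on_le_max[OF convex_on_subset[OF cvx this]] show ?thesis using that by auto
  qed
  show "1/12 < cl"
  proof (rule ccontr)
    assume "\<not> 1/12 < cl"
    then show False using mid[of cl "1/12" "1/10"] cl_root(1) F12 F10 Fl by auto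
  qed
  show "cl < 1/10"
  proof (rule ccontr)
    assume "\<not> cl < 1/10"
    then show False using mid[of "1/10" cl "1/4"] cl_root F10 F4 Fl by auto
  qed
qed

lemma cr_bounds: "4/5 < cr" "cr < 1" "cl < cr"
  using cl_bounds by (auto simp: cr_def)

lemma cc_pos: "0 < cc"
  using cl_bounds cr_bounds by (simp add: cc_def)

lemma ln_cc: "ln cc = ln cl + 2 * ln cr"
  using cl_bounds cr_bounds by (simp add: cc_def ln_mult ln_realpow)

section \<open>The potential on the contact set and its derivative\<close>

lemma dual_f_low: "x \<le> cl \<Longrightarrow> dual_f x =
    cc * ln cl - (1/3) * (cc * ln cc - cc) + (1/6) * ((2 * x - 1) ^ 3 - (2 * cl - 1) ^ 3)"
  by (simp add: dual_f_def)

lemma dual_f_mid: "cl \<le> x \<Longrightarrow> x \<le> cr \<Longrightarrow> dual_f x = cc * ln x - (1/3) * (cc * ln cc - cc)"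
  by (auto simp: dual_f_def)

lemma dual_f_high: "cr \<le> x \<Longrightarrow> dual_f x =
    cc * ln cr - (1/3) * (cc * ln cc - cc) + (1/4) * (x\<^sup>2 - cr\<^sup>2) - (1/6) * (x ^ 3 - cr ^ 3)"
  using cr_bounds by (auto simp: dual_f_def)

text \<open>The additive constant of the logarithmic branch is tuned so that three copies of it turn
  \<open>cc * ln cc\<close> into \<open>cc\<close>.\<close>

lemma contact_mid:
  assumes "x \<in> {cl..cr}" "y \<in> {cl..cr}" "z \<in> {cl..cr}" "x * y * z = cc"
  shows "dual_f x + dual_f y + dual_f z = x * y * z"
proof -
  have pos: "0 < x" "0 < y" "0 < z" using assms cl_bounds by auto
  have "cc * (ln x + ln y + ln z) = cc * ln cc"
    using pos by (simp add: assms(4)[symmetric] ln_mult del: assms(4))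
  then show ?thesis using assms by (simp add: dual_f_mid algebra_simps)
qed

text \<open>The logarithms cancel by \<open>ln_cc\<close>; what remains is a polynomial identity in
  b = 1 - 2t and \<open>cr\<close>.\<close>

lemma contact_tail:
  assumes "t \<le> cl"
  shows "dual_f t + 2 * dual_f (1 - 2 * t) = t * (1 - 2 * t)\<^sup>2"
proof -
  have l: "cl = (1 - cr) / 2" by (simp add: cr_def)
  define b where "b = 1 - 2 * t"
  have t: "t = (1 - b) / 2" by (simp add: b_def)
  have b: "cr \<le> b" using assms by (simp add: b_def cr_def)
  have c: "cc = (1 - cr) / 2 * cr\<^sup>2" by (simp add: cc_def l)
  have "dual_f t + 2 * dual_f b = cc * (ln cl + 2 * ln cr) - (cc * ln cc - cc)
     + (1/6) * ((2 * t - 1) ^ 3 - (2 * cl - 1) ^ 3) + (1/2) * (b\<^sup>2 - cr\<^sup>2) - (1/3) * (b ^ 3 - cr ^ 3)"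
    unfolding dual_f_low[OF assms] dual_f_high[OF b] by (simp add: field_simps)
  also have "\<dots> = (1 - cr) / 2 * cr\<^sup>2 + (1/6) * ((- b) ^ 3 - (- cr) ^ 3) + (1/2) * (b\<^sup>2 - cr\<^sup>2) - (1/3) * (b ^ 3 - cr ^ 3)"
  proof -
    have "2 * t - 1 = - b" "2 * cl - 1 = - cr" by (simp_all add: t l field_simps)
    then show ?thesis unfolding ln_cc[symmetric] by (simp add: c)
  qed
  also have "\<dots> = (1 - b) / 2 * b\<^sup>2" by (simp add: field_simps eval_nat_numeral)
  finally show ?thesis by (simp add: b_def)
qed

text \<open>At a contact point each branch is the product of the other two coordinates: twice 1 - 2x
  on the first, two factors with product \<open>cc / x\<close> on the second, \<open>x\<close> and
  (1 - x)/2 on the third.\<close>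

definition dual_f' :: "real \<Rightarrow> real" where
  "dual_f' x = (if x \<le> cl then (1 - 2 * x)\<^sup>2 else if x \<le> cr then cc / x else x * (1 - x) / 2)"

lemma has_field_derivative_glue:
  fixes f g h :: "real \<Rightarrow> real"
  assumes g: "(g has_real_derivative D) (at a)" and h: "(h has_real_derivative D) (at a)"
    and fg: "\<forall>\<^sub>F x in at_left a. f x = g x" and fh: "\<forall>\<^sub>F x in at_right a. f x = h x"
    and a: "f a = g a" "f a = h a"
  shows "(f has_real_derivative D) (at a)"
  unfolding has_field_derivative_iff
proof (rule filterlim_split_at)
  have "((\<lambda>y. (g y - g a) / (y - a)) \<longlongrightarrow> D) (at_left a)"
    using g unfolding has_field_derivative_iff by (rule filterlim_mono) (auto intro: at_le)
  then show "((\<lambda>y. (f y - f a) / (y - a)) \<longlongrightarrow> D) (at_left a)"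
    by (rule Lim_transform_eventually) (use fg a in \<open>auto elim: eventually_mono\<close>)
  have "((\<lambda>y. (h y - h a) / (y - a)) \<longlongrightarrow> D) (at_right a)"
    using h unfolding has_field_derivative_iff by (rule filterlim_mono) (auto intro: at_le)
  then show "((\<lambda>y. (f y - f a) / (y - a)) \<longlongrightarrow> D) (at_right a)"
    by (rule Lim_transform_eventually) (use fh a in \<open>auto elim: eventually_mono\<close>)
qed

text \<open>At the breakpoints the one-sided derivatives agree because
  \<open>cc = cl * cr\<^sup>2\<close> and \<open>cr = 1 - 2 * cl\<close>. The outer polynomial
  branches continue past 0 and 1, so the derivative is two-sided everywhere.\<close>

lemma DERIV_dual_f: "(dual_f has_real_derivative dual_f' x) (at x)"
proof -
  define p1 where "p1 = (\<lambda>x. cc * ln cl - (1/3) * (cc * ln cc - cc) + (1/6) * ((2 * x - 1) ^ 3 - (2 * cl - 1) ^ 3))"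
  define p2 where "p2 = (\<lambda>x. cc * ln x - (1/3) * (cc * ln cc - cc))"
  define p3 where "p3 = (\<lambda>x. cc * ln cr - (1/3) * (cc * ln cc - cc) + (1/4) * (x\<^sup>2 - cr\<^sup>2) - (1/6) * (x ^ 3 - cr ^ 3))"
  have d1: "(p1 has_real_derivative (1 - 2 * x)\<^sup>2) (at x)"
    unfolding p1_def by (auto intro!: derivative_eq_intros simp: power2_eq_square field_simps)
  have d2: "(p2 has_real_derivative cc / x) (at x)" if "x > 0"
    unfolding p2_def using that by (auto intro!: derivative_eq_intros)
  have d3: "(p3 has_real_derivative x * (1 - x) / 2) (at x)"
    unfolding p3_def by (auto intro!: derivative_eq_intros simp: power2_eq_square field_simps)
  have left: "\<forall>\<^sub>F y in at_left x. c < y \<and> y < x" if "c < x" for c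
    using eventually_at_left_real[OF that] by simp
  have right: "\<forall>\<^sub>F y in at_right x. x < y \<and> y < c" if "x < c" for c
    using eventually_at_right_real[OF that] by simp
  have glue: "(dual_f has_real_derivative dual_f' x) (at x)"
    if "(g has_real_derivative dual_f' x) (at x)" "(h has_real_derivative dual_f' x) (at x)"
      "u < x" "\<And>y. u < y \<Longrightarrow> y \<le> x \<Longrightarrow> dual_f y = g y" "x < v" "\<And>y. x \<le> y \<Longrightarrow> y < v \<Longrightarrow> dual_f y = h y"
    for g h u v
  proof (rule has_field_derivative_glue[OF that(1,2)])
    show "\<forall>\<^sub>F y in at_left x. dual_f y = g y" using left[OF that(3)] by (rule eventually_mono) (simp add: that(4))
    show "\<forall>\<^sub>F y in at_right x. dual_f y = h y" using right[OF that(5)] by (rule eventually_mono) (simp add: that(6))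
    show "dual_f x = g x" using that(3) by (intro that(4)) auto
    show "dual_f x = h x" using that(5) by (intro that(6)) auto
  qed
  consider "x < cl" | "x = cl" | "cl < x" "x < cr" | "x = cr" | "cr < x" by linarith
  then show ?thesis
  proof cases
    case 1
    then show ?thesis using d1
      by (intro glue[of p1 p1 "x - 1" cl]) (auto simp: dual_f'_def dual_f_low p1_def)
  next
    case 2
    have "cc / x = (1 - 2 * x)\<^sup>2" using 2 cl_bounds by (simp add: cc_def cr_def)
    then have "(p2 has_real_derivative dual_f' x) (at x)" using d2 2 cl_bounds by (simp add: dual_f'_def)
    then show ?thesis using 2 d1 cr_bounds
      by (intro glue[of p1 p2 "x - 1" cr]) (auto simp: dual_f'_def dual_f_low dual_f_mid p1_def p2_def)
  next
    case 3
    then show ?thesis using d2 cl_bounds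
      by (intro glue[of p2 p2 cl cr]) (auto simp: dual_f'_def dual_f_mid p2_def)
  next
    case 4
    have "x * (1 - x) / 2 = cc / x" using 4 cr_bounds by (simp add: cc_def cr_def power2_eq_square)
    then have "(p3 has_real_derivative dual_f' x) (at x)" using d3 4 cr_bounds by (simp add: dual_f'_def)
    then show ?thesis using 4 d2 cl_bounds cr_bounds
      by (intro glue[of p2 p3 cl "x + 1"]) (auto simp: dual_f'_def dual_f_mid dual_f_high p2_def p3_def)
  next
    case 5
    then show ?thesis using d3 cr_bounds
      by (intro glue[of p3 p3 cr "x + 1"]) (auto simp: dual_f'_def dual_f_high p3_def)
  qed
qed

lemma isCont_dual_f: "isCont dual_f x"
  by (rule DERIV_isCont[OF DERIV_dual_f])

section \<open>Critical points of the defect\<close>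

lemma dual_f'_nonneg: "x \<in> {0..1} \<Longrightarrow> 0 \<le> dual_f' x"
  using cc_pos cl_bounds cr_bounds by (auto simp: dual_f'_def)

lemma dual_f_mono: "0 \<le> x \<Longrightarrow> x \<le> y \<Longrightarrow> y \<le> 1 \<Longrightarrow> dual_f x \<le> dual_f y"
  by (rule DERIV_nonneg_imp_nondecreasing[of x y dual_f])
    (auto intro!: exI conjI DERIV_dual_f dual_f'_nonneg)

text \<open>First-order condition in one variable. The end point 1 is impossible:
  \<open>dual_f' 1 = 0 < w\<close>, so a small move to the left would decrease the function.\<close>

lemma dual_f_argmin:
  assumes x: "0 < x" "x \<le> 1" and w: "0 < w"
    and min: "\<And>x'. x' \<in> {0..1} \<Longrightarrow> x * w - dual_f x \<le> x' * w - dual_f x'"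
  shows "x < 1" "dual_f' x = w"
proof -
  define G where "G = (\<lambda>x. x * w - dual_f x)"
  have d: "(G has_real_derivative (w - dual_f' x)) (at x)" for x
  proof -
    have "((\<lambda>x. x * w) has_real_derivative w) (at x)" by (auto intro!: derivative_eq_intros)
    from DERIV_diff[OF this DERIV_dual_f] show ?thesis unfolding G_def .
  qed
  show x1: "x < 1"
  proof (rule ccontr)
    assume "\<not> x < 1"
    then have "x = 1" using x by simp
    have "w - dual_f' 1 > 0" using w cl_bounds cr_bounds by (simp add: dual_f'_def)
    from DERIV_pos_inc_left[OF d this] obtain e where e: "e > 0" "\<And>h. 0 < h \<Longrightarrow> h < e \<Longrightarrow> G (1 - h) < G 1" by blast
    define h where "h = min (e / 2) (1/2)"
    have "G (1 - h) < G 1" "1 - h \<in> {0..1}" using e by (auto simp: h_def min_def)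
    then show False using min[of "1 - h"] \<open>x = 1\<close> by (simp add: G_def)
  qed
  have "w - dual_f' x = 0"
  proof (rule DERIV_local_min[OF d])
    show "0 < min x (1 - x)" using x x1 by simp
    show "\<forall>y. \<bar>x - y\<bar> < min x (1 - x) \<longrightarrow> G x \<le> G y"
    proof (intro allI impI)
      fix y assume "\<bar>x - y\<bar> < min x (1 - x)"
      then have "y \<in> {0..1}" by auto
      then show "G x \<le> G y" using min by (simp add: G_def)
    qed
  qed
  then show "dual_f' x = w" by simp
qed

text \<open>The cubic is \<open>x * dual_f' x\<close> on the first branch; its derivative (1 - 2t)(1
  - 6t) is positive below 1/6.\<close>

lemma cubic_strict_mono:
  assumes "0 \<le> a" "a < b" "b \<le> 1/6"
  shows "a * (1 - 2 * a)\<^sup>2 < b * (1 - 2 * (b::real))\<^sup>2"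
proof -
  have "b * (1 - 2 * b)\<^sup>2 - a * (1 - 2 * a)\<^sup>2 = (b - a) * (1 - 4 * (a + b) + 4 * (a\<^sup>2 + a * b + b\<^sup>2))"
    by (simp add: field_simps power2_eq_square)
  moreover have "1 - 4 * (a + b) + 4 * (a\<^sup>2 + a * b + b\<^sup>2) = (1 - 2 * (a + b))\<^sup>2 - 4 * a * b"
    by (simp add: field_simps power2_eq_square)
  moreover have "(1 - 2 * (a + b))\<^sup>2 > 4 * a * b"
  proof -
    have "(1/3)\<^sup>2 < (1 - 2 * (a + b))\<^sup>2" using assms by (intro power_strict_mono) auto
    moreover have "a * b \<le> 1/6 * (1/6)" using assms by (intro mult_mono) auto
    ultimately show ?thesis by (simp add: power2_eq_square)
  qed
  ultimately have "0 < b * (1 - 2 * b)\<^sup>2 - a * (1 - 2 * a)\<^sup>2" using assms by simp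
  then show ?thesis by simp
qed

text \<open>Levels below \<open>cc\<close> occur only on the outer branches. The cubic is injective
  on the lower one, and x -> (1 - x)/2 carries the upper one to it.\<close>

lemma critical_below:
  assumes "0 < m" "m < cc"
  obtains a where "0 < a" "a < cl" "a * (1 - 2 * a)\<^sup>2 = m"
    "\<And>x. 0 < x \<Longrightarrow> x < 1 \<Longrightarrow> x * dual_f' x = m \<Longrightarrow> x = a \<or> x = 1 - 2 * a"
proof -
  define k where "k = (\<lambda>t::real. t * (1 - 2 * t)\<^sup>2)"
  have kl: "k cl = cc" by (simp add: k_def cc_def cr_def)
  have "\<exists>a\<ge>0. a \<le> cl \<and> k a = m"
    using assms kl cl_bounds by (intro IVT') (auto simp: k_def intro!: continuous_intros)
  then obtain a where a: "0 \<le> a" "a \<le> cl" "k a = m" by blast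
  then have a': "0 < a" "a < cl" using assms kl by (auto simp: k_def less_le)
  have uniq: "t = a" if "0 < t" "t \<le> cl" "k t = m" for t
    using cubic_strict_mono[of t a] cubic_strict_mono[of a t] that a cl_bounds
    by (cases t a rule: linorder_cases) (auto simp: k_def)
  show thesis
  proof (rule that[of a])
    fix x :: real assume x: "0 < x" "x < 1" "x * dual_f' x = m"
    consider "x \<le> cl" | "cl < x" "x \<le> cr" | "cr < x" by linarith
    then show "x = a \<or> x = 1 - 2 * a"
    proof cases
      case 1
      then show ?thesis using x uniq[of x] by (simp add: dual_f'_def k_def)
    next
      case 2
      then show ?thesis using x assms by (simp add: dual_f'_def)
    next
      case 3
      have "(1 - x) / 2 = a"
      proof (rule uniq)
        show "0 < (1 - x) / 2" using x by simp
        show "(1 - x) / 2 \<le> cl" using 3 by (simp add: cr_def)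
        have "1 - 2 * ((1 - x) / 2) = x" by (simp add: field_simps)
        then have "k ((1 - x) / 2) = (1 - x) / 2 * x\<^sup>2" unfolding k_def by (simp only:)
        then show "k ((1 - x) / 2) = m" using x 3 cr_bounds by (simp add: dual_f'_def power2_eq_square algebra_simps)
      qed
      then show ?thesis by simp
    qed
  qed (use a' a k_def in auto)
qed

text \<open>Outside [\<open>cl\<close>, \<open>cr\<close>] the product is the cubic at a point below
  \<open>cl\<close>, namely \<open>x\<close> or (1 - x)/2, hence less than its value
  \<open>cc\<close> at \<open>cl\<close>.\<close>

lemma critical_le:
  assumes "0 < x" "x < 1"
  shows "x * dual_f' x \<le> cc" "x * dual_f' x = cc \<Longrightarrow> x \<in> {cl..cr}"
proof -
  define k where "k = (\<lambda>t::real. t * (1 - 2 * t)\<^sup>2)"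
  have kl: "k cl = cc" by (simp add: k_def cc_def cr_def)
  have lt: "k t < cc" if "0 \<le> t" "t < cl" for t
    using cubic_strict_mono[of t cl] that cl_bounds kl by (simp add: k_def)
  consider "x < cl" | "x \<in> {cl..cr}" | "cr < x" by fastforce
  then have "x * dual_f' x < cc \<or> x * dual_f' x = cc \<and> x \<in> {cl..cr}"
  proof cases
    case 1
    then show ?thesis using lt[of x] assms by (simp add: dual_f'_def k_def)
  next
    case 2
    then have "x * dual_f' x = cc" using assms by (auto simp: dual_f'_def cc_def cr_def)
    then show ?thesis using 2 by simp
  next
    case 3
    have "1 - 2 * ((1 - x) / 2) = x" by (simp add: field_simps)
    then have "k ((1 - x) / 2) = (1 - x) / 2 * x\<^sup>2" unfolding k_def by (simp only:)
    moreover have "k ((1 - x) / 2) < cc" using lt[of "(1 - x) / 2"] 3 assms by (simp add: cr_def)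
    ultimately show ?thesis using 3 cr_bounds by (simp add: dual_f'_def power2_eq_square algebra_simps)
  qed
  then show "x * dual_f' x \<le> cc" "x * dual_f' x = cc \<Longrightarrow> x \<in> {cl..cr}" by auto
qed

text \<open>All three coordinates lie on the level x y z of t -> t f'(t). If the level is
  \<open>cc\<close>, all lie in [\<open>cl\<close>, \<open>cr\<close>]; otherwise each is
  \<open>a\<close> or \<open>b = 1 - 2 * a\<close>.\<close>

lemma critical_contact:
  assumes pos: "0 < x" "0 < y" "0 < z" and lt: "x < 1" "y < 1" "z < 1"
    and crit: "dual_f' x = y * z" "dual_f' y = x * z" "dual_f' z = x * y"
  shows "dual_f x + dual_f y + dual_f z = x * y * z"
proof (cases "x * y * z = cc")
  case True
  then show ?thesis
    using critical_le(2)[OF pos(1) lt(1)] critical_le(2)[OF pos(2) lt(2)] critical_le(2)[OF pos(3) lt(3)] crit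
    by (intro contact_mid) (auto simp: ac_simps)
next
  case False
  have k: "x * dual_f' x = x * y * z" "y * dual_f' y = x * y * z" "z * dual_f' z = x * y * z"
    using crit by simp_all
  have "0 < x * y * z" "x * y * z < cc"
    using pos False critical_le(1)[OF pos(1) lt(1)] k(1) by auto
  then obtain a where a: "0 < a" "a < cl" "a * (1 - 2 * a)\<^sup>2 = x * y * z"
    and ab: "\<And>t. 0 < t \<Longrightarrow> t < 1 \<Longrightarrow> t * dual_f' t = x * y * z \<Longrightarrow> t = a \<or> t = 1 - 2 * a"
    using critical_below by blast
  define b where "b = 1 - 2 * a"
  have b: "b > a" "b > 0" using a cl_bounds by (auto simp: b_def)
  have m: "x * y * z = a * b\<^sup>2" using a by (simp add: b_def)
  have c: "dual_f a + 2 * dual_f b = a * b\<^sup>2" using contact_tail[of a] a by (simp add: b_def)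
  have xs: "x = a \<or> x = b" "y = a \<or> y = b" "z = a \<or> z = b"
    using ab[OF pos(1) lt(1) k(1)] ab[OF pos(2) lt(2) k(2)] ab[OF pos(3) lt(3) k(3)] by (auto simp: b_def)
  \<comment> \<open>As \<open>a < b\<close>, only one \<open>a\<close> with two \<open>b\<close> has
    the product \<open>a * b\<^sup>2\<close>, which leaves the permutations of a tail contact
    point.\<close>
  have ne: "a * a * a \<noteq> a * b\<^sup>2" "a * a * b \<noteq> a * b\<^sup>2" "b * b * b \<noteq> a * b\<^sup>2"
    using a b mult_strict_mono'[of a b a b] by (auto simp: power2_eq_square)
  show ?thesis using xs m ne c by (elim disjE) (auto simp: power2_eq_square ac_simps)
qed

text \<open>The minimum of \<open>H\<close> over the cube is examined. With a zero coordinate,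
  monotonicity and \<open>dual_f 0 + 2 * dual_f 1 = 0\<close> give \<open>H \<ge> 0\<close>;
  otherwise \<open>dual_f_argmin\<close> in each variable yields the critical equations.\<close>

lemma dual_f_feasible:
  assumes "x \<in> {0..1}" "y \<in> {0..1}" "z \<in> {0..1}"
  shows "dual_f x + dual_f y + dual_f z \<le> x * y * z"
proof -
  define C where "C = ({0..1} \<times> {0..1} \<times> {0..1} :: (real \<times> real \<times> real) set)"
  define H where "H = (\<lambda>(x, y, z). x * y * z - (dual_f x + dual_f y + dual_f z))"
  have cont: "continuous_on UNIV dual_f" using isCont_dual_f by (simp add: continuous_on_eq_continuous_at)
  have "compact C" unfolding C_def by (intro compact_Times compact_Icc)
  moreover have "C \<noteq> {}" by (auto simp: C_def)
  moreover have "continuous_on C H"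
    unfolding H_def case_prod_beta
    by (intro continuous_intros continuous_on_compose2[OF cont]) auto
  ultimately obtain p where p: "p \<in> C" "\<And>q. q \<in> C \<Longrightarrow> H p \<le> H q"
    using continuous_attains_inf[of C H] by auto
  obtain u v w where pe: "p = (u, v, w)" by (cases p) auto
  have uvw: "u \<in> {0..1}" "v \<in> {0..1}" "w \<in> {0..1}" using p pe by (auto simp: C_def)
  have min: "H (u, v, w) \<le> H (u', v', w')" if "u' \<in> {0..1}" "v' \<in> {0..1}" "w' \<in> {0..1}" for u' v' w'
    using p(2)[of "(u', v', w')"] that pe by (simp add: C_def)
  have f0: "dual_f 0 + 2 * dual_f 1 = 0" using contact_tail[of 0] cl_bounds by simp
  have le1: "dual_f t \<le> dual_f 1" if "t \<in> {0..1}" for t using dual_f_mono[of t 1] that by auto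
  have "0 \<le> H (u, v, w)"
  proof (cases "u = 0 \<or> v = 0 \<or> w = 0")
    case True
    then show ?thesis using f0 le1[OF uvw(1)] le1[OF uvw(2)] le1[OF uvw(3)] by (auto simp: H_def)
  next
    case False
    then have pos: "0 < u" "0 < v" "0 < w" using uvw by auto
    have U: "u < 1" "dual_f' u = v * w"
      using dual_f_argmin[of u "v * w"] min[OF _ uvw(2,3)] uvw pos by (auto simp: H_def algebra_simps)
    have V: "v < 1" "dual_f' v = u * w"
      using dual_f_argmin[of v "u * w"] min[OF uvw(1) _ uvw(3)] uvw pos by (auto simp: H_def algebra_simps)
    have W: "w < 1" "dual_f' w = u * v"
      using dual_f_argmin[of w "u * v"] min[OF uvw(1,2)] uvw pos by (auto simp: H_def algebra_simps)
    show ?thesis using critical_contact[OF pos U(1) V(1) W(1) U(2) V(2) W(2)] by (simp add: H_def)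
  qed
  also have "H (u, v, w) \<le> H (x, y, z)" using min assms by blast
  finally show ?thesis by (simp add: H_def)
qed

subsection \<open>Optimality\<close>

text \<open>The exponential weight is the Jacobian, up to the factor \<open>L * r\<close>. Its
  reciprocal is bounded on the unit interval, so the composition without the weight is integrable
  too.\<close>

lemma exp_substitution:
  fixes f :: "real \<Rightarrow> real" and L r :: real
  assumes L: "0 < L" and r: "0 < r" and f: "f absolutely_integrable_on {r * exp (- L)..r}"
  shows "(\<lambda>v. f (r * exp (- L * v))) absolutely_integrable_on {0..1}"
    and "integral {r * exp (- L)..r} f = L * r * integral {0..1} (\<lambda>v. f (r * exp (- L * v)) * exp (- L * v))"
proof -
  define g where "g = (\<lambda>v. r * exp (- L * v))"
  have img: "g ` {0..1} = {r * exp (- L)..r}"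
  proof (intro equalityI subsetI)
    fix x assume "x \<in> g ` {0..1}"
    then show "x \<in> {r * exp (- L)..r}" using L r by (auto simp: g_def)
  next
    fix x assume x: "x \<in> {r * exp (- L)..r}"
    have "0 < r * exp (- L)" using r by simp
    then have x0: "0 < x" using x by simp
    define v where "v = (ln r - ln x) / L"
    have "ln (r * exp (- L)) \<le> ln x" using x x0 r by (subst ln_le_cancel_iff) auto
    then have "ln r - L \<le> ln x" using r by (simp add: ln_mult)
    moreover have "ln x \<le> ln r" using x x0 r by (subst ln_le_cancel_iff) auto
    ultimately have "v \<in> {0..1}" using L by (simp add: v_def field_simps)
    moreover have "g v = x" using L r x0 by (simp add: g_def v_def exp_diff)
    ultimately show "x \<in> g ` {0..1}" by blast
  qed
  have inj: "inj_on g {0..1}" using L r by (auto simp: inj_on_def g_def)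
  have der: "(g has_field_derivative (- L * g x)) (at x within {0..1})" for x
    unfolding g_def by (auto intro!: derivative_eq_intros)
  have cv: "(\<lambda>x. \<bar>- L * g x\<bar> * f (g x)) absolutely_integrable_on {0..1} \<and>
      integral {0..1} (\<lambda>x. \<bar>- L * g x\<bar> * f (g x)) = integral {r * exp (- L)..r} f"
    using has_absolute_integral_change_of_variables_1'[OF _ der inj, of f "integral {r * exp (- L)..r} f"] f img
    by simp
  have w: "\<bar>- L * g x\<bar> * f (g x) = L * r * (f (r * exp (- L * x)) * exp (- L * x))" for x
    using L r by (simp add: g_def abs_mult)
  have cv': "(\<lambda>x. L * r * (f (r * exp (- L * x)) * exp (- L * x))) absolutely_integrable_on {0..1}"
    using cv unfolding w by simp
  have ce: "continuous_on {0..1} (\<lambda>x. exp (L * x) / (L * r))" using L r by (intro continuous_intros) auto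
  have "(\<lambda>x. (exp (L * x) / (L * r)) * (L * r * (f (r * exp (- L * x)) * exp (- L * x)))) absolutely_integrable_on {0..1}"
    using ce by (intro absolutely_integrable_bounded_measurable_product_real[OF _ _ _ cv'])
      (auto intro: continuous_imp_measurable_on_sets_lebesgue compact_imp_bounded compact_continuous_image)
  moreover have "(exp (L * x) / (L * r)) * (L * r * (f (r * exp (- L * x)) * exp (- L * x))) = f (r * exp (- L * x))" for x
    using L r by (simp add: field_simps flip: exp_add)
  ultimately show "(\<lambda>v. f (r * exp (- L * v))) absolutely_integrable_on {0..1}" by simp
  show "integral {r * exp (- L)..r} f = L * r * integral {0..1} (\<lambda>v. f (r * exp (- L * v)) * exp (- L * v))"
    using cv unfolding w by simp
qed

lemma contact_integral_le_0:
  fixes \<phi> :: "real \<Rightarrow> real"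
  assumes \<phi>: "\<phi> absolutely_integrable_on {0..1}"
    and contact: "\<And>x y z. x \<in> {0..1} \<Longrightarrow> y \<in> {0..1} \<Longrightarrow> z \<in> {0..1} \<Longrightarrow>
      dual_f x + dual_f y + dual_f z = x * y * z \<Longrightarrow> \<phi> x + \<phi> y + \<phi> z \<le> 0"
  shows "integral {0..1} \<phi> \<le> 0"
proof -
  have \<phi>i: "\<phi> integrable_on {0..1}" using \<phi> by (simp add: absolutely_integrable_on_def)
  define F where "F = (\<lambda>x. integral {0..x} \<phi>)"
  have F0: "F 0 = 0" by (simp add: F_def)
  have tail: "F cl + F 1 - F cr \<le> 0"
  proof -
    \<comment> \<open>The contact curve is run through with t = \<open>cl * x\<close>. The
      coordinate 1 - 2t moves twice as fast but occurs twice, so both end intervals receive the same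
      weight.\<close>
    have "(F cl - F 0) / (cl - 0) + 2 * ((F cr - F 1) / (cr - 1)) \<le> 0"
    proof (rule has_integral_le)
      show "((\<lambda>x. \<phi> (0 + (cl - 0) * x) + 2 * \<phi> (1 + (cr - 1) * x)) has_integral
          (F cl - F 0) / (cl - 0) + 2 * ((F cr - F 1) / (cr - 1))) {0..1}"
        unfolding F_def using cl_bounds cr_bounds
        by (intro has_integral_add has_integral_mult_right has_integral_segment \<phi>i) auto
      show "((\<lambda>x. 0) has_integral (0::real)) {0..1::real}" by simp
      fix x :: real assume x: "x \<in> {0..1}"
      define t where "t = cl * x"
      have t: "0 \<le> t" "t \<le> cl" using x cl_bounds by (auto simp: t_def mult_left_le)
      have eq: "1 + (cr - 1) * x = 1 - 2 * t" by (simp add: cr_def t_def)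
      have "\<phi> t + \<phi> (1 - 2 * t) + \<phi> (1 - 2 * t) \<le> 0"
        using contact_tail[OF t(2)] t cl_bounds by (intro contact) (auto simp: power2_eq_square)
      then show "\<phi> (0 + (cl - 0) * x) + 2 * \<phi> (1 + (cr - 1) * x) \<le> 0"
        unfolding eq by (simp add: t_def)
    qed
    moreover have "cr - 1 = - 2 * cl" by (simp add: cr_def)
    ultimately have "(F cl + F 1 - F cr) / cl \<le> 0"
      using cl_bounds by (simp add: F0 field_simps)
    then show ?thesis using cl_bounds by (simp add: divide_le_0_iff)
  qed
  have mid: "F cr - F cl \<le> 0"
  proof -
    \<comment> \<open>With this \<open>L\<close> the defining equation of \<open>cl\<close> reads
      \<open>exp (- L) = cl / cr\<close>.\<close>
    define L where "L = 3 - 9 * cl"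
    have L: "0 < L" "L \<le> 9/4" using cl_bounds by (auto simp: L_def)
    have "- L = ln (cl / cr)" using cl_root cl_bounds cr_bounds by (simp add: L_def cr_def ln_div)
    then have eL: "exp (- L) = cl / cr" using cl_bounds cr_bounds by simp
    have E3: "exp (- L / 3) ^ 3 = cl / cr" unfolding eL[symmetric] by (simp flip: exp_of_nat_mult)
    \<comment> \<open>The bounds on \<open>cl\<close> put \<open>cl / cr\<close> between 1/10 and
      1/8, and the cube of 23/50 is below 1/10.\<close>
    have E1: "23/50 \<le> exp (- L / 3)"
    proof (rule power_le_imp_le_base[of _ 2])
      have "1/10 \<le> cl / cr" using cl_bounds cr_bounds by (simp add: cr_def field_simps)
      then show "(23/50) ^ Suc 2 \<le> exp (- L / 3) ^ Suc 2" using E3 by (simp add: eval_nat_numeral)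
    qed simp
    have E2: "exp (- L / 3) \<le> 1/2"
    proof (rule power_le_imp_le_base[of _ 2])
      have "cl / cr \<le> 1/8" using cl_bounds cr_bounds by (simp add: cr_def field_simps)
      then show "exp (- L / 3) ^ Suc 2 \<le> (1/2) ^ Suc 2" using E3 by (simp add: eval_nat_numeral)
    qed simp
    \<comment> \<open>Here \<open>3 + 2 * L = 9 * cr\<close> and \<open>3 - L = 9 * cl\<close>: the
      equation for \<open>cl\<close> is exactly the condition that the weight has mean 1/3.\<close>
    have mean: "exp (- L) * (3 + 2 * L) = 3 - L"
    proof -
      have "3 + 2 * L = 9 * cr" by (simp add: L_def cr_def)
      then show ?thesis unfolding eL using cr_bounds cl_bounds by (simp add: L_def)
    qed
    have rl: "cr * exp (- L) = cl" using cr_bounds cl_bounds by (simp add: eL)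
    have \<phi>m: "\<phi> absolutely_integrable_on {cl..cr}"
      by (rule set_integrable_subset[OF \<phi>]) (use cl_bounds cr_bounds in auto)
    have in_mid: "cr * exp (- L * v) \<in> {cl..cr}" if "v \<in> {0..1}" for v
    proof -
      have "exp (- L) \<le> exp (- L * v)" using that L by (simp add: mult_left_le)
      then have "cr * exp (- L) \<le> cr * exp (- L * v)" using cr_bounds by (intro mult_left_mono) auto
      then show ?thesis using that L cr_bounds by (simp add: rl)
    qed
    have r0: "0 < cr" using cr_bounds by simp
    have "integral {cl..cr} \<phi> = L * cr * integral {0..1} (\<lambda>v. \<phi> (cr * exp (- L * v)) * exp (- L * v))"
      using exp_substitution(2)[OF L(1) r0, of \<phi>] \<phi>m by (simp add: rl)
    moreover have "integral {0..1} (\<lambda>v. \<phi> (cr * exp (- L * v)) * exp (- L * v)) \<le> 0"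
    proof (rule exp_weighted_integral_le_0[OF _ _ L E1 E2 mean])
      show "(\<lambda>v. \<phi> (cr * exp (- L * v))) absolutely_integrable_on {0..1}"
        using exp_substitution(1)[OF L(1) r0, of \<phi>] \<phi>m by (simp add: rl)
    next
      fix a b c :: real assume abc: "a \<in> {0..1}" "b \<in> {0..1}" "c \<in> {0..1}" "a + b + c = 1"
      have "exp (- L * a) * exp (- L * b) * exp (- L * c) = exp (- L * (a + b + c))"
        by (simp add: algebra_simps flip: exp_add)
      also have "\<dots> = cl / cr" using abc eL by simp
      finally have "cr * exp (- L * a) * (cr * exp (- L * b)) * (cr * exp (- L * c)) = cr ^ 3 * (cl / cr)"
        by (simp add: power3_eq_cube ac_simps)
      also have "\<dots> = cc" using r0 by (simp add: cc_def power2_eq_square power3_eq_cube)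
      finally have "dual_f (cr * exp (- L * a)) + dual_f (cr * exp (- L * b)) + dual_f (cr * exp (- L * c))
         = cr * exp (- L * a) * (cr * exp (- L * b)) * (cr * exp (- L * c))"
        using abc by (intro contact_mid in_mid)
      moreover have "cr * exp (- L * v) \<in> {0..1}" if "v \<in> {0..1}" for v
        using in_mid[OF that] cl_bounds cr_bounds unfolding atLeastAtMost_iff by linarith
      ultimately show "\<phi> (cr * exp (- L * a)) + \<phi> (cr * exp (- L * b)) + \<phi> (cr * exp (- L * c)) \<le> 0"
        using abc by (intro contact)
    qed
    ultimately have "integral {cl..cr} \<phi> \<le> 0" using L r0 by (simp add: mult_nonneg_nonpos)
    moreover have "F cl + integral {cl..cr} \<phi> = F cr"
      unfolding F_def using cl_bounds cr_bounds
      by (intro Henstock_Kurzweil_Integration.integral_combine integrable_subinterval_real[OF \<phi>i]) auto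
    ultimately show ?thesis by simp
  qed
  show ?thesis using tail mid by (simp add: F_def)
qed

theorem proposition4p7:
  shows "dual_solution (\<lambda>x y z. x * y * z) dual_f dual_f dual_f"
  unfolding dual_solution_def
proof (intro conjI allI impI)
  have int: "set_integrable lebesgue {0..1} dual_f"
    using isCont_dual_f by (intro absolutely_integrable_continuous_real continuous_at_imp_continuous_on) auto
  then show "dual_admissible (\<lambda>x y z. x * y * z) dual_f dual_f dual_f"
    using dual_f_feasible by (simp add: dual_admissible_def)
  fix f' g' h' assume adm: "dual_admissible (\<lambda>x y z. x * y * z) f' g' h'"
  then have i': "set_integrable lebesgue {0..1} f'" "set_integrable lebesgue {0..1} g'" "set_integrable lebesgue {0..1} h'"
    and le: "\<And>x y z. x \<in> {0..1} \<Longrightarrow> y \<in> {0..1} \<Longrightarrow> z \<in> {0..1} \<Longrightarrow> f' x + g' y + h' z \<le> x * y * z"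
    by (auto simp: dual_admissible_def)
  define \<phi> where "\<phi> = (\<lambda>x. f' x + g' x + h' x - 3 * dual_f x)"
  have ai: "\<phi> absolutely_integrable_on {0..1}"
    unfolding \<phi>_def using i' int
    by (intro set_integral_diff(1) set_integral_add(1) set_integrable_mult_right) auto
  have "integral {0..1} \<phi> \<le> 0"
  proof (rule contact_integral_le_0[OF ai])
    fix x y z :: real
    assume xyz: "x \<in> {0..1}" "y \<in> {0..1}" "z \<in> {0..1}" and eq: "dual_f x + dual_f y + dual_f z = x * y * z"
    \<comment> \<open>Summing the constraint over cyclic shifts evaluates each competitor function
      once at each of the three points.\<close>
    have "f' x + g' y + h' z \<le> x * y * z" "f' y + g' z + h' x \<le> x * y * z" "f' z + g' x + h' y \<le> x * y * z"
      using le[of x y z] le[of y z x] le[of z x y] xyz by (simp_all add: ac_simps)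
    then show "\<phi> x + \<phi> y + \<phi> z \<le> 0" using eq by (simp add: \<phi>_def)
  qed
  moreover have "(\<phi> has_integral integral {0..1} f' + integral {0..1} g' + integral {0..1} h' - 3 * integral {0..1} dual_f) {0..1}"
    unfolding \<phi>_def using i' int set_lebesgue_integral_eq_integral(1)
    by (intro has_integral_diff has_integral_add has_integral_mult_right integrable_integral) auto
  ultimately show "dual_value f' g' h' \<le> dual_value dual_f dual_f dual_f"
    unfolding dual_value_def using i' int by (simp add: set_lebesgue_integral_eq_integral(2) integral_unique)
qed

end
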